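(* There exists a unique probability distribution $\mathcal{W}_0$ on $Graph_*$ for which, in the environment $\mathcal{W}=\mathcal{W}_0$, the process $\mathcal{C}^{\mathcal{W}}_1(t)$ almost surely explodes (i.e. $t_\infty<\infty$ a.s.) and the distribution of the isomorphism class of $\mathcal{C}^{\mathcal{W}}(0)$ is precisely $\mathcal{W}_0$. For $(G,r)$ distributed according to $\mathcal{W}_0$, the distribution of $|G|$ (the number of vertices) is $$\mathbb{P}(|G|=k)=\frac{2}{k}\binom{2k-2}{k-1}4^{-k},\qquad k\ge 1.$$ Moreover $\mathcal{W}_0$ is supported on the set $\mathcal{T}_*$ of isomorphism classes of finite rooted trees.
   Context: $Graph_*$ is the set of isomorphism classes of finite rooted simple undirected graphs. For a probability law $\mathcal{W}$ on $Graph_*$ (the "environment"), the continuous-time Markov process $\mathcal{C}_1^{\mathcal{W}}(t)$ of finite rooted graphs is defined as follows. At time $t_0=0$ it is a single vertex $\rho$, the root. When the current graph has $k$ vertices, the process waits an independent exponential time of rate $k$ and then jumps: an independent rooted graph $(C,r)$ with law $\mathcal{W}$ is attached to the current graph by adding an edge from $r$ to an independent uniformly random vertex of the current graph; the root remains $\rho$. Let $t_1<t_2<\dots$ be the jump times and $t_\infty=\lim_i t_i$; the process is defined on $[0,t_\infty)$. (If $t_\infty<\infty$ almost surely then $t_\infty$ has an exponential tail, so $\mathbb{E}(t_\infty)<\infty$.) If $\mathbb{E}(t_\infty)<\infty$, then $\mathcal{C}^{\mathcal{W}}(t)$, $t\in\mathbb{R}$, denotes the stationary regenerative Markov process with the same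 evolution, except that at each explosion time it instantaneously returns to the singleton graph. It is constructed by concatenating independent copies of $\mathcal{C}_1^{\mathcal{W}}$ on consecutive time intervals partitioning $\mathbb{R}$, where the copy whose interval contains time $0$ is size-biased in proportion to its lifetime $t_\infty$ and time $0$ is placed at an independent uniformly distributed position in that interval. *)

theory Defs
  imports "HOL-Probability.Probability" "HOL-Library.Nat_Bijection"
begin

datatype 'a rooted_graph =
  Rooted_Graph (vertices: "'a set") (edges: "'a set set") (root_vertex: 'a)

definition finite_rooted_graph :: "'a rooted_graph \<Rightarrow> bool" where
  "finite_rooted_graph G \<longleftrightarrow>
     finite (vertices G) \<and> root_vertex G \<in> vertices G \<and>
     (\<forall>e\<in>edges G. e \<subseteq> vertices G \<and> card e = 2)"

definition graph_iso :: "('a \<Rightarrow> 'b) \<Rightarrow> 'a rooted_graph \<Rightarrow> 'b rooted_graph \<Rightarrow> bool" where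
  "graph_iso f G H \<longleftrightarrow>
     bij_betw f (vertices G) (vertices H) \<and> edges H = image f ` edges G \<and>
     root_vertex H = f (root_vertex G)"

definition isomorphic :: "'a rooted_graph \<Rightarrow> 'b rooted_graph \<Rightarrow> bool" where
  "isomorphic G H \<longleftrightarrow>
     finite_rooted_graph G \<and> finite_rooted_graph H \<and> (\<exists>f. graph_iso f G H)"

lemma graph_iso_inv:
  assumes G: "finite_rooted_graph G" and f: "graph_iso f G H"
  shows "graph_iso (inv_into (vertices G) f) H G"
proof -
  let ?g = "inv_into (vertices G) f"
  have b: "bij_betw f (vertices G) (vertices H)"
    using f by (simp add: graph_iso_def)
  have sub: "?g ` f ` e = e" if "e \<in> edges G" for e
    using that G b by (auto simp: finite_rooted_graph_def bij_betw_def inv_into_image_cancel)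
  have "image ?g ` edges H = edges G"
    using f sub by (simp add: graph_iso_def image_image)
  moreover have "root_vertex G = ?g (root_vertex H)"
    using f G b by (simp add: graph_iso_def finite_rooted_graph_def bij_betw_inv_into_left)
  ultimately show ?thesis
    using b by (simp add: graph_iso_def bij_betw_inv_into)
qed

lemma graph_iso_trans:
  assumes "graph_iso f G H" "graph_iso g H K"
  shows "graph_iso (g \<circ> f) G K"
  using assms by (auto simp: graph_iso_def image_comp intro: bij_betw_trans)

lemma part_equivp_isomorphic: "part_equivp (isomorphic :: 'a rooted_graph \<Rightarrow> _)"
proof (rule part_equivpI)
  have "isomorphic G G" if "finite_rooted_graph G" for G :: "'a rooted_graph"
    using that by (auto simp: isomorphic_def graph_iso_def intro!: exI[of _ id])
  moreover have "finite_rooted_graph (Rooted_Graph {undefined :: 'a} {} undefined)"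
    by (simp add: finite_rooted_graph_def)
  ultimately show "\<exists>G :: 'a rooted_graph. isomorphic G G" by blast
  show "symp (isomorphic :: 'a rooted_graph \<Rightarrow> _)"
    by (intro sympI) (unfold isomorphic_def, blast intro: graph_iso_inv)
  show "transp (isomorphic :: 'a rooted_graph \<Rightarrow> _)"
    by (intro transpI) (unfold isomorphic_def, blast intro: graph_iso_trans)
qed

quotient_type graph_class = "nat rooted_graph" / partial: isomorphic
  by (rule part_equivp_isomorphic)

text \<open>Every finite rooted graph is isomorphic to one with vertices in \<^typ>\<open>nat\<close>, so this
  type is the set of all isomorphism classes.  It is countable; hence \<^typ>\<open>graph_class pmf\<close> is the
  type of all probability laws on it.\<close>

lemma graph_class_countable: "countable (UNIV :: graph_class set)"
proof -
  let ?F = "Collect finite :: nat set set"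
  let ?I = "?F \<times> {E. finite E \<and> E \<subseteq> ?F} \<times> (UNIV :: nat set)"
  let ?g = "\<lambda>(V, E, r). abs_graph_class (Rooted_Graph V E r)"
  have "countable ?F" by (rule countable_Collect_finite)
  then have "countable {E. finite E \<and> E \<subseteq> ?F}"
    using countable_Collect_finite_subset by blast
  then have "countable ?I"
    using \<open>countable ?F\<close> by (intro countable_SIGMA) auto
  moreover have "x \<in> ?g ` ?I" for x
  proof -
    obtain G where G: "isomorphic G G" "x = abs_graph_class G"
      using Quotient3_abs_rep[OF Quotient3_graph_class] Quotient3_rep_reflp[OF Quotient3_graph_class]
      by metis
    have "finite_rooted_graph G" using G(1) by (simp add: isomorphic_def)
    then have "edges G \<subseteq> Pow (vertices G)" "finite (vertices G)"
      by (auto simp: finite_rooted_graph_def)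
    moreover from this have "edges G \<subseteq> ?F" "finite (edges G)"
      by (auto intro: finite_subset)
    ultimately show ?thesis
      using G(2) by (intro image_eqI[of _ _ "(vertices G, edges G, root_vertex G)"]) auto
  qed
  then have "(UNIV :: graph_class set) \<subseteq> ?g ` ?I" by (rule subsetI)
  ultimately show ?thesis
    by (elim countable_subset[OF _ countable_image])
qed

instance graph_class :: countable
proof
  show "\<exists>to_nat :: graph_class \<Rightarrow> nat. inj to_nat"
    using graph_class_countable unfolding countable_def .
qed

lift_definition num_vertices :: "graph_class \<Rightarrow> nat" is "\<lambda>G. card (vertices G)"
  unfolding isomorphic_def graph_iso_def by (blast intro: bij_betw_same_card)

lift_definition singleton_graph :: graph_class is "Rooted_Graph {0} {} 0"
  by (simp add: isomorphic_def graph_iso_def finite_rooted_graph_def exI[of _ id])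

definition adjacent :: "'a rooted_graph \<Rightarrow> ('a \<times> 'a) set" where
  "adjacent G = {(u, v). {u, v} \<in> edges G}"

definition connected_graph :: "'a rooted_graph \<Rightarrow> bool" where
  "connected_graph G \<longleftrightarrow> (\<forall>u\<in>vertices G. \<forall>v\<in>vertices G. (u, v) \<in> (adjacent G)\<^sup>*)"

definition cycle :: "'a rooted_graph \<Rightarrow> 'a list \<Rightarrow> bool" where
  "cycle G c \<longleftrightarrow>
     3 \<le> length c \<and> distinct c \<and>
     (\<forall>i<length c. (c ! i, c ! (Suc i mod length c)) \<in> adjacent G)"

definition tree :: "'a rooted_graph \<Rightarrow> bool" where
  "tree G \<longleftrightarrow> connected_graph G \<and> (\<nexists>c. cycle G c)"

lemma adjacent_iso:
  assumes "graph_iso f G H" "(u, v) \<in> adjacent G"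
  shows "(f u, f v) \<in> adjacent H"
proof -
  have "f ` {u, v} \<in> image f ` edges G"
    using assms(2) unfolding adjacent_def by blast
  then show ?thesis using assms(1) by (simp add: adjacent_def graph_iso_def)
qed

lemma tree_iso:
  assumes "finite_rooted_graph G" "finite_rooted_graph H" "graph_iso f G H" "tree G"
  shows "tree H"
  unfolding tree_def
proof
  have b: "bij_betw f (vertices G) (vertices H)"
    using assms(3) by (simp add: graph_iso_def)
  have path: "(f u, f v) \<in> (adjacent H)\<^sup>*" if "(u, v) \<in> (adjacent G)\<^sup>*" for u v
    using that by induction (auto intro: rtrancl_into_rtrancl adjacent_iso[OF assms(3)])
  show "connected_graph H"
    unfolding connected_graph_def
  proof (intro ballI)
    fix x y assume "x \<in> vertices H" "y \<in> vertices H"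
    then obtain u v where "x = f u" "y = f v" "u \<in> vertices G" "v \<in> vertices G"
      using b unfolding bij_betw_def by (metis imageE)
    then show "(x, y) \<in> (adjacent H)\<^sup>*"
      using assms(4) path by (simp add: tree_def connected_graph_def)
  qed
  let ?g = "inv_into (vertices G) f"
  have g: "graph_iso ?g H G" using graph_iso_inv assms(1,3) .
  show "\<nexists>c. cycle H c"
  proof
    assume "\<exists>c. cycle H c"
    then obtain c where c: "cycle H c" ..
    have "set c \<subseteq> vertices H"
    proof
      fix x assume "x \<in> set c"
      then obtain i where "i < length c" "c ! i = x" by (auto simp: in_set_conv_nth)
      then have "(x, c ! (Suc i mod length c)) \<in> adjacent H"
        using c unfolding cycle_def by blast
      then show "x \<in> vertices H"
        using assms(2) unfolding adjacent_def finite_rooted_graph_def by blast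
    qed
    then have "inj_on ?g (set c)"
      using g unfolding graph_iso_def bij_betw_def by (meson inj_on_subset)
    moreover have "Suc i mod length c < length c" if "i < length c" for i
      using that by (intro mod_less_divisor) linarith
    ultimately have "cycle G (map ?g c)"
      using c adjacent_iso[OF g] by (simp add: cycle_def distinct_map)
    then show False using assms(4) by (auto simp: tree_def)
  qed
qed

lift_definition is_tree :: "graph_class \<Rightarrow> bool" is tree
  unfolding isomorphic_def by (blast intro: graph_iso_inv tree_iso)

definition rooted_trees :: "graph_class set" where
  "rooted_trees = {G. is_tree G}"

text \<open>The even numbers encode the vertices of \<open>G\<close> and the odd ones those of \<open>C\<close>, so that the
  union is disjoint.\<close>

definition attach :: "nat rooted_graph \<Rightarrow> nat rooted_graph \<Rightarrow> nat \<Rightarrow> nat rooted_graph" where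
  "attach G C v =
     (let old = (\<lambda>x. sum_encode (Inl x)); new = (\<lambda>x. sum_encode (Inr x))
      in Rooted_Graph
           (old ` vertices G \<union> new ` vertices C)
           (image old ` edges G \<union> image new ` edges C \<union> {{old v, new (root_vertex C)}})
           (old (root_vertex G)))"

lemma finite_rooted_graph_attach:
  assumes "finite_rooted_graph G" "finite_rooted_graph C" "v \<in> vertices G"
  shows "finite_rooted_graph (attach G C v)"
proof -
  have "card ((\<lambda>x. sum_encode (Inl x)) ` e) = card e"
    and "card ((\<lambda>x. sum_encode (Inr x)) ` e) = card e" for e :: "nat set"
    by (auto intro!: card_image inj_onI simp: sum_encode_eq)
  moreover have "card {sum_encode (Inl x), sum_encode (Inr y)} = 2" for x y
    by (simp add: card_2_iff') (use sum_encode_eq in blast)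
  moreover have "f ` e \<subseteq> f ` vertices G" if "e \<in> edges G" for e and f :: "nat \<Rightarrow> nat"
    using that assms(1) by (intro image_mono) (simp add: finite_rooted_graph_def)
  moreover have "f ` e \<subseteq> f ` vertices C" if "e \<in> edges C" for e and f :: "nat \<Rightarrow> nat"
    using that assms(2) by (intro image_mono) (simp add: finite_rooted_graph_def)
  ultimately show ?thesis
    using assms by (simp add: finite_rooted_graph_def attach_def Let_def ball_Un le_supI1 le_supI2)
qed

lemma attach_iso:
  assumes f: "graph_iso f G G'" and h: "graph_iso h C C'"
  shows "\<exists>k. graph_iso k (attach G C v) (attach G' C' (f v))"
proof -
  define k where "k = sum_encode \<circ> map_sum f h \<circ> sum_decode"
  have k: "k (sum_encode (Inl x)) = sum_encode (Inl (f x))"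
          "k (sum_encode (Inr x)) = sum_encode (Inr (h x))" for x
    by (simp_all add: k_def)
  have inj: "inj_on k (vertices (attach G C v))"
  proof (rule inj_onI)
    fix x y
    assume x: "x \<in> vertices (attach G C v)" and y: "y \<in> vertices (attach G C v)"
      and "k x = k y"
    have "inj_on f (vertices G)" "inj_on h (vertices C)"
      using f h by (auto simp: graph_iso_def bij_betw_def)
    with x y \<open>k x = k y\<close> show "x = y"
      unfolding attach_def Let_def rooted_graph.sel
      by (elim UnE imageE) (simp_all add: k sum_encode_eq inj_on_eq_iff)
  qed
  have "vertices G' = f ` vertices G" "vertices C' = h ` vertices C"
    using f h by (auto simp: graph_iso_def bij_betw_def)
  then have "k ` vertices (attach G C v) = vertices (attach G' C' (f v))"
    by (simp add: attach_def Let_def image_Un image_image k)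
  moreover have "edges (attach G' C' (f v)) = image k ` edges (attach G C v)"
    using f h by (simp add: attach_def Let_def image_Un image_image k graph_iso_def)
  moreover have "root_vertex (attach G' C' (f v)) = k (root_vertex (attach G C v))"
    using f by (simp add: attach_def Let_def k graph_iso_def)
  ultimately show ?thesis
    using inj by (auto simp: graph_iso_def bij_betw_def)
qed

text \<open>A vertex is not determined by an isomorphism class, but the law of the class obtained by
  attaching at a uniformly random vertex is.\<close>

lift_definition attach_uniform :: "graph_class \<Rightarrow> graph_class \<Rightarrow> graph_class pmf" is
  "\<lambda>G C. map_pmf (\<lambda>v. abs_graph_class (attach G C v)) (pmf_of_set (vertices G))"
proof -
  fix G G' C C' :: "nat rooted_graph"
  assume G: "isomorphic G G'" and C: "isomorphic C C'"
  then obtain f h where f: "graph_iso f G G'" and h: "graph_iso h C C'"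
    by (auto simp: isomorphic_def)
  have V: "finite (vertices G)" "vertices G \<noteq> {}"
    using G by (auto simp: isomorphic_def finite_rooted_graph_def)
  have bij: "bij_betw f (vertices G) (vertices G')"
    using f by (simp add: graph_iso_def)
  have V': "pmf_of_set (vertices G') = map_pmf f (pmf_of_set (vertices G))"
    using map_pmf_of_set_bij_betw[OF bij] V by simp
  have "abs_graph_class (attach G C v) = abs_graph_class (attach G' C' (f v))"
    if "v \<in> vertices G" for v
  proof (rule Quotient3_rel_abs[OF Quotient3_graph_class])
    have "f v \<in> vertices G'" using that bij by (auto simp: bij_betw_def)
    then show "isomorphic (attach G C v) (attach G' C' (f v))"
      using that G C attach_iso[OF f h, of v]
      by (auto simp: isomorphic_def intro: finite_rooted_graph_attach)
  qed
  then show "map_pmf (\<lambda>v. abs_graph_class (attach G C v)) (pmf_of_set (vertices G)) =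
             map_pmf (\<lambda>v. abs_graph_class (attach G' C' v)) (pmf_of_set (vertices G'))"
    unfolding V' map_pmf_comp using V by (intro map_pmf_cong) auto
qed

definition jump :: "graph_class pmf \<Rightarrow> graph_class \<Rightarrow> graph_class pmf" where
  "jump W G = bind_pmf W (attach_uniform G)"

lemma num_vertices_pos: "0 < num_vertices G"
  by transfer (auto simp: isomorphic_def finite_rooted_graph_def card_gt_0_iff)

text \<open>Coordinate \<open>n\<close> of a trajectory is the waiting time between the \<open>n\<close>-th and the
  \<open>(n + 1)\<close>-st jump, paired with the graph reached by the latter; the initial graph is not
  recorded.\<close>

type_synonym trajectory = "nat \<Rightarrow> real \<times> graph_class"

definition graph_after :: "trajectory \<Rightarrow> nat \<Rightarrow> graph_class" where
  "graph_after \<omega> n = (case n of 0 \<Rightarrow> singleton_graph | Suc m \<Rightarrow> snd (\<omega> m))"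

definition jump_time :: "trajectory \<Rightarrow> nat \<Rightarrow> real" where
  "jump_time \<omega> n = (\<Sum>i<n. fst (\<omega> i))"

definition explosion_time :: "trajectory \<Rightarrow> ennreal" where
  "explosion_time \<omega> = (SUP n. ennreal (jump_time \<omega> n))"

text \<open>For \<open>0 \<le> t < explosion_time \<omega>\<close> the least \<open>n\<close> with \<open>t < t\<^bsub>n+1\<^esub>\<close> is the one with
  \<open>t\<^sub>n \<le> t < t\<^bsub>n+1\<^esub>\<close>; the value at other \<open>t\<close> is irrelevant.\<close>

definition C1_path :: "trajectory \<Rightarrow> real \<Rightarrow> graph_class" where
  "C1_path \<omega> t = graph_after \<omega> (LEAST n. t < jump_time \<omega> (Suc n))"

definition step_space :: "(real \<times> graph_class) measure" where
  "step_space = borel \<Otimes>\<^sub>M count_space UNIV"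

definition step_law :: "graph_class pmf \<Rightarrow> graph_class \<Rightarrow> (real \<times> graph_class) measure" where
  "step_law W G =
     density lborel (exponential_density (real (num_vertices G))) \<Otimes>\<^sub>M measure_pmf (jump W G)"

lemma sets_step_law: "sets (step_law W G) = sets step_space"
  unfolding step_law_def step_space_def by (intro sets_pair_measure_cong) auto

lemma prob_space_step_law: "prob_space (step_law W G)"
proof -
  interpret A: prob_space "density lborel (exponential_density (real (num_vertices G)))"
    using num_vertices_pos by (intro prob_space_exponential_density) simp
  interpret pair_prob_space
    "density lborel (exponential_density (real (num_vertices G)))" "measure_pmf (jump W G)" ..
  show ?thesis unfolding step_law_def by unfold_locales
qed

interpretation C1: Ionescu_Tulcea
  "\<lambda>n \<omega>. step_law W (graph_after \<omega> n)" "\<lambda>_. step_space" for W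
proof (rule Ionescu_Tulcea.intro)
  fix n
  have "(\<lambda>\<omega>. graph_after \<omega> n) \<in> PiM {0..<n} (\<lambda>_. step_space) \<rightarrow>\<^sub>M count_space UNIV"
    unfolding graph_after_def step_space_def by (cases n) auto
  moreover have "step_law W \<in> count_space UNIV \<rightarrow>\<^sub>M subprob_algebra step_space"
    by (auto simp: space_subprob_algebra sets_step_law prob_space_step_law
        prob_space_imp_subprob_space)
  ultimately show "(\<lambda>\<omega>. step_law W (graph_after \<omega> n))
      \<in> PiM {0..<n} (\<lambda>_. step_space) \<rightarrow>\<^sub>M subprob_algebra step_space"
    by (rule measurable_compose)
qed (rule prob_space_step_law)

definition C1_law :: "graph_class pmf \<Rightarrow> trajectory measure" where
  "C1_law W = C1.PF.lim W"

definition explosive :: "graph_class pmf \<Rightarrow> bool" where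
  "explosive W \<longleftrightarrow> (AE \<omega> in C1_law W. explosion_time \<omega> < \<infinity>)"

definition size_biased_law :: "graph_class pmf \<Rightarrow> trajectory measure" where
  "size_biased_law W =
     density (C1_law W)
       (\<lambda>\<omega>. explosion_time \<omega> / (\<integral>\<^sup>+\<omega>'. explosion_time \<omega>' \<partial>C1_law W))"

text \<open>A sample point \<open>(u, X)\<close> consists of the relative position \<open>u\<close> of time \<open>0\<close> in the interval
  of copy \<open>0\<close>, and of the copies \<open>X n\<close>.  This is meaningful only when the explosion time has
  finite expectation, which follows from \<open>explosive W\<close>.\<close>

definition regenerative_space :: "graph_class pmf \<Rightarrow> (real \<times> (int \<Rightarrow> trajectory)) measure" where
  "regenerative_space W =
     uniform_measure lborel {0..1} \<Otimes>\<^sub>M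
     PiM UNIV (\<lambda>n. if n = 0 then size_biased_law W else C1_law W)"

definition lifetime :: "trajectory \<Rightarrow> real" where
  "lifetime \<omega> = enn2real (explosion_time \<omega>)"

definition start_time :: "real \<times> (int \<Rightarrow> trajectory) \<Rightarrow> int \<Rightarrow> real" where
  "start_time = (\<lambda>(u, X) n.
     - u * lifetime (X 0) +
     (if 0 \<le> n then (\<Sum>i\<in>{0..<n}. lifetime (X i)) else - (\<Sum>i\<in>{n..<0}. lifetime (X i))))"

definition stationary_process :: "real \<times> (int \<Rightarrow> trajectory) \<Rightarrow> real \<Rightarrow> graph_class" where
  "stationary_process p t =
     (let n = (THE n. start_time p n \<le> t \<and> t < start_time p (n + 1))
      in C1_path (snd p n) (t - start_time p n))"

definition stationary_law :: "graph_class pmf \<Rightarrow> real \<Rightarrow> graph_class measure" where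
  "stationary_law W t =
     distr (regenerative_space W) (count_space UNIV) (\<lambda>p. stationary_process p t)"

end

theory Submission
  imports Defs
begin

text \<open>At a fixed time the stationary process sits in one copy of the explosive process, and it shows the
  class \<open>G\<close> with probability proportional to the expected time that a copy spends at \<open>G\<close>.  This expected
  time is \<open>U G / \<bar>G\<bar>\<close>, where \<open>U\<close> (\<open>green W\<close> below) is the expected number of visits of the chain of
  successive graphs.  So \<open>W\<close> is the law at time 0 exactly when \<open>U G = c \<bar>G\<bar> W(G)\<close>, with
  \<open>c = E t\<^sub>\<infinity>\<close> (\<open>stationary_law_formula\<close>; if \<open>c = \<infinity>\<close>, the formal law at time 0 has mass 0 and is not
  a probability law).

  Every jump enlarges the graph, so \<open>U\<close> is the only solution of the renewal equation
  \<open>U = \<delta> + U J\<close>, with \<open>\<delta>\<close> the point mass at the singleton and \<open>J\<close> the jump kernel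
  (\<open>satisfies_renewal_unique\<close>).  Insert \<open>U G = c \<bar>G\<bar> W(G)\<close>.  A graph \<open>H\<close> made by attaching
  \<open>C\<close> to \<open>G\<close> has \<open>\<bar>H\<bar> = \<bar>G\<bar> + \<bar>C\<bar>\<close>, and in \<open>U J\<close> both \<open>G\<close> and \<open>C\<close> are governed by \<open>W\<close>; symmetrising in
  the pair turns the weight \<open>\<bar>G\<bar> / \<bar>H\<bar>\<close> into one half of a genuine probability, and the equation
  becomes \<open>c W = \<delta> + (c/2) M(W)\<close> (\<open>size_weighted_jump\<close>).  Here \<open>M(W)\<close> is the law of the graph obtained
  from two independent samples of \<open>W\<close> by choosing a uniform vertex of their disjoint union and joining
  it to the root of the component that does not contain it.  Comparing total masses gives
  \<open>c = 1 + c/2\<close>, hence \<open>c = 2\<close> and \<open>W = \<delta>/2 + M(W)/2\<close>.  Conversely, a solution of this last equation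
  makes \<open>2 \<bar>G\<bar> W(G)\<close> a solution of the renewal equation, whence \<open>c = \<Sum>\<^sub>G 2 W(G) = 2\<close>: the
  process explodes and \<open>W\<close> is its law at time 0.

  Everything else is read off the fixed point equation \<open>W = \<delta>/2 + M(W)/2\<close>.  It describes the value
  of a critical binary branching tree, with a singleton at each leaf and a merger at each branching;
  such a tree is finite almost surely, so a solution exists (\<open>lossless_random_merging\<close>).
  Merging adds sizes, so induction on the size gives uniqueness, and also that only trees occur, since
  attaching a tree to a tree gives a tree.  The sizes satisfy
  \<open>w\<^sub>k = [k = 1]/2 + (\<Sum>\<^sub>i w\<^sub>i w\<^bsub>k-i\<^esub>)/2\<close>, which says that the generating function is
  \<open>1 - (1 - s)\<^bsup>1/2\<^esup>\<close>, and its coefficients are the stated Catalan weights.\<close>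

section \<open>Attaching rooted graphs\<close>

abbreviation old_vertex :: "nat \<Rightarrow> nat" where "old_vertex x \<equiv> sum_encode (Inl x)"
abbreviation new_vertex :: "nat \<Rightarrow> nat" where "new_vertex x \<equiv> sum_encode (Inr x)"

lemma old_new_cases: obtains (old) a where "x = old_vertex a" | (new) a where "x = new_vertex a"
  by (metis sum_decode_inverse sum.exhaust)

lemma inj_old_new: "inj old_vertex" "inj new_vertex"
  by (auto intro!: injI simp: sum_encode_eq)

lemma old_neq_new [simp]: "old_vertex a \<noteq> new_vertex b" "new_vertex b \<noteq> old_vertex a"
  by (simp_all add: sum_encode_eq)

lemma inj_image_family_mem_iff: "inj f \<Longrightarrow> f ` e \<in> image f ` E \<longleftrightarrow> e \<in> E"
  by (auto simp: inj_image_eq_iff)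

lemma adjacent_sym: "(a, b) \<in> adjacent G \<Longrightarrow> (b, a) \<in> adjacent G"
  by (simp add: adjacent_def insert_commute)

lemma edges_attach:
  "edges (attach G C v) = image old_vertex ` edges G \<union> image new_vertex ` edges C \<union>
     {{old_vertex v, new_vertex (root_vertex C)}}"
  by (simp add: attach_def Let_def)

lemma vertices_attach:
  "vertices (attach G C v) = old_vertex ` vertices G \<union> new_vertex ` vertices C"
  by (simp add: attach_def Let_def)

lemma adjacent_attach_old:
  "(old_vertex a, old_vertex b) \<in> adjacent (attach G C v) \<longleftrightarrow> (a, b) \<in> adjacent G"
proof -
  have "{old_vertex a, old_vertex b} \<in> image old_vertex ` edges G \<longleftrightarrow> {a, b} \<in> edges G"
    using inj_image_family_mem_iff[OF inj_old_new(1), of "{a, b}" "edges G"] by simp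
  moreover have "{old_vertex a, old_vertex b} \<notin> image new_vertex ` edges C"
    using old_neq_new by (fastforce dest: equalityD1)
  moreover have "{old_vertex a, old_vertex b} \<noteq> {old_vertex v, new_vertex (root_vertex C)}"
    by (auto dest: equalityD2)
  ultimately show ?thesis by (simp add: adjacent_def edges_attach)
qed

lemma adjacent_attach_new:
  "(new_vertex a, new_vertex b) \<in> adjacent (attach G C v) \<longleftrightarrow> (a, b) \<in> adjacent C"
proof -
  have "{new_vertex a, new_vertex b} \<in> image new_vertex ` edges C \<longleftrightarrow> {a, b} \<in> edges C"
    using inj_image_family_mem_iff[OF inj_old_new(2), of "{a, b}" "edges C"] by simp
  moreover have "{new_vertex a, new_vertex b} \<notin> image old_vertex ` edges G"
    using old_neq_new by (fastforce dest: equalityD1)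
  moreover have "{new_vertex a, new_vertex b} \<noteq> {old_vertex v, new_vertex (root_vertex C)}"
    by (auto dest: equalityD2)
  ultimately show ?thesis by (simp add: adjacent_def edges_attach)
qed

lemma adjacent_attach_old_new:
  "(old_vertex a, new_vertex b) \<in> adjacent (attach G C v) \<longleftrightarrow> a = v \<and> b = root_vertex C"
proof -
  have "{old_vertex a, new_vertex b} \<notin> image new_vertex ` edges C"
    "{old_vertex a, new_vertex b} \<notin> image old_vertex ` edges G"
    using old_neq_new by (fastforce dest: equalityD1)+
  then show ?thesis by (auto simp: adjacent_def edges_attach doubleton_eq_iff sum_encode_eq)
qed

text \<open>Every vertex is joined to the end \<open>v\<close> of the new edge: within \<open>G\<close> if it is old, and through the
  new edge and \<open>C\<close> if it is new.\<close>

lemma connected_attach: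
  assumes G: "connected_graph G" and C: "connected_graph C"
    and v: "v \<in> vertices G" and r: "root_vertex C \<in> vertices C"
  shows "connected_graph (attach G C v)"
proof -
  let ?R = "(adjacent (attach G C v))\<^sup>*"
  have old: "(old_vertex a, old_vertex b) \<in> ?R" if "(a, b) \<in> (adjacent G)\<^sup>*" for a b
    using that by induction (auto intro: rtrancl_into_rtrancl simp: adjacent_attach_old)
  have new: "(new_vertex a, new_vertex b) \<in> ?R" if "(a, b) \<in> (adjacent C)\<^sup>*" for a b
    using that by induction (auto intro: rtrancl_into_rtrancl simp: adjacent_attach_new)
  have "sym (adjacent (attach G C v))" by (auto intro: symI adjacent_sym)
  then have sym: "(x, y) \<in> ?R \<Longrightarrow> (y, x) \<in> ?R" for x y by (meson sym_rtrancl symD)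
  have bridge: "(old_vertex v, new_vertex (root_vertex C)) \<in> ?R"
    by (auto simp: adjacent_attach_old_new)
  have "(old_vertex v, x) \<in> ?R" if "x \<in> vertices (attach G C v)" for x
    using that G C v r
    by (auto simp: vertices_attach connected_graph_def intro: old rtrancl_trans[OF bridge new])
  then show ?thesis
    unfolding connected_graph_def using sym by (meson rtrancl_trans)
qed

text \<open>A cycle that stays among the old or among the new vertices is a cycle of \<open>G\<close> or of \<open>C\<close>.  Any other
  cycle crosses from old to new and back again.  Both crossings use the only edge between the two
  parts, in opposite directions, so the cycle would have length 2.\<close>

lemma acyclic_attach:
  assumes G: "\<nexists>c. cycle G c" and C: "\<nexists>c. cycle C c"
  shows "\<not> cycle (attach G C v) c"
proof
  assume c: "cycle (attach G C v) c"
  define L where "L = length c"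
  \<comment> \<open>The cycle is unrolled to a periodic sequence, so that its last edge needs no special treatment.\<close>
  define x where "x i = c ! (i mod L)" for i
  have L: "3 \<le> L" and dist: "distinct c" using c by (auto simp: cycle_def L_def)
  have adj: "(x i, x (Suc i)) \<in> adjacent (attach G C v)" for i
  proof -
    have "i mod L < length c" using L by (auto simp: L_def intro!: mod_less_divisor)
    then have "(c ! (i mod L), c ! (Suc (i mod L) mod length c)) \<in> adjacent (attach G C v)"
      using c unfolding cycle_def by blast
    then show ?thesis by (simp add: x_def L_def mod_Suc_eq)
  qed
  have x_inj: "i mod L = j mod L" if "x i = x j" for i j
    using that dist L nth_eq_iff_index_eq[OF dist, of "i mod L" "j mod L"] L
      mod_less_divisor[of L i] mod_less_divisor[of L j]
    by (simp add: x_def L_def[symmetric])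
  have x_period: "x (i + L) = x i" for i by (simp add: x_def)
  have cyc: "cycle H (map f c)" if "inj_on f (set c)" "\<And>i. (f (x i), f (x (Suc i))) \<in> adjacent H"
    for f and H :: "nat rooted_graph"
  proof -
    have "(map f c ! i, map f c ! (Suc i mod length (map f c))) \<in> adjacent H" if i: "i < L" for i
    proof -
      have "Suc i mod L < L" using L by (intro mod_less_divisor) linarith
      then show ?thesis using \<open>\<And>i. (f (x i), f (x (Suc i))) \<in> adjacent H\<close>[of i] i
        by (simp add: x_def L_def)
    qed
    then show ?thesis using that(1) L dist by (auto simp: cycle_def L_def distinct_map)
  qed
  have in_x: "\<exists>i. y = x i" if "y \<in> set c" for y
    using that by (auto simp: x_def L_def in_set_conv_nth) (metis mod_less)
  show False
  proof (cases "(\<forall>i. \<exists>a. x i = old_vertex a) \<or> (\<forall>i. \<exists>a. x i = new_vertex a)")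
    case True
    then show False
    proof
      assume all: "\<forall>i. \<exists>a. x i = old_vertex a"
      then obtain a where a: "\<And>i. x i = old_vertex (a i)" by metis
      have "cycle G (map (inv old_vertex) c)"
      proof (rule cyc)
        show "inj_on (inv old_vertex) (set c)"
          using in_x a by (intro inj_on_inv_into) auto
        show "(inv old_vertex (x i), inv old_vertex (x (Suc i))) \<in> adjacent G" for i
          using adj[of i] by (simp add: a inv_f_f[OF inj_old_new(1)] adjacent_attach_old)
      qed
      with G show False by blast
    next
      assume all: "\<forall>i. \<exists>a. x i = new_vertex a"
      then obtain a where a: "\<And>i. x i = new_vertex (a i)" by metis
      have "cycle C (map (inv new_vertex) c)"
      proof (rule cyc)
        show "inj_on (inv new_vertex) (set c)"
          using in_x a by (intro inj_on_inv_into) auto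
        show "(inv new_vertex (x i), inv new_vertex (x (Suc i))) \<in> adjacent C" for i
          using adj[of i] by (simp add: a inv_f_f[OF inj_old_new(2)] adjacent_attach_new)
      qed
      with C show False by blast
    qed
  next
    case False
    define P where "P i \<longleftrightarrow> (\<exists>a. x i = old_vertex a)" for i
    have notP: "\<not> P i \<longleftrightarrow> (\<exists>a. x i = new_vertex a)" for i
      unfolding P_def by (cases "x i" rule: old_new_cases) auto
    have step: "\<exists>k\<ge>i. Q k \<and> \<not> Q (Suc k)" if "Q i" "\<not> Q j" "i \<le> j" for Q :: "nat \<Rightarrow> bool" and i j
      using that(3,1,2) by (induction j rule: dec_induct) (auto intro: exI)
    obtain i j where "P i" "\<not> P j" using False notP unfolding P_def by metis
    have shift: "P (n + k * L) \<longleftrightarrow> P n" for n k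
      by (simp add: P_def x_def)
    \<comment> \<open>A shift by a multiple of the period puts the second of two given indices behind the first.\<close>
    have far: "a \<le> b + a * L" for a b
      using L by (cases L) auto
    obtain k where k: "P k" "\<not> P (Suc k)"
      using step[of P i "j + i * L"] \<open>P i\<close> \<open>\<not> P j\<close> far[of i j] by (auto simp: shift)
    obtain l where l: "\<not> P l" "P (Suc l)"
      using step[of "\<lambda>n. \<not> P n" j "i + j * L"] \<open>P i\<close> \<open>\<not> P j\<close> far[of j i] by (auto simp: shift)
    have "x k = old_vertex v" "x (Suc k) = new_vertex (root_vertex C)"
      using k notP[of "Suc k"] adj[of k] by (auto simp: P_def adjacent_attach_old_new)
    moreover have "x (Suc l) = old_vertex v" "x l = new_vertex (root_vertex C)"
      using l notP[of l] adjacent_sym[OF adj[of l]] by (auto simp: P_def adjacent_attach_old_new)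
    ultimately have "Suc l mod L = k mod L" "l mod L = Suc k mod L"
      by (auto intro!: x_inj)
    then have "Suc (Suc k) mod L = k mod L" by (metis mod_Suc_eq)
    then have "L dvd 2"
      using mod_eq_dvd_iff_nat[of k "Suc (Suc k)" L] by simp
    with L show False by (auto dest: dvd_imp_le)
  qed
qed

lemma tree_attach:
  assumes "tree G" "tree C" "v \<in> vertices G" "root_vertex C \<in> vertices C"
  shows "tree (attach G C v)"
  using assms connected_attach acyclic_attach unfolding tree_def by blast

lemma graph_class_cases:
  obtains G where "finite_rooted_graph G" "x = abs_graph_class G"
  by (metis Quotient3_abs_rep Quotient3_rep_reflp Quotient3_graph_class isomorphic_def)

lemma isomorphic_refl_iff: "isomorphic G G \<longleftrightarrow> finite_rooted_graph G"
  by (auto simp: isomorphic_def graph_iso_def intro!: exI[of _ id])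

lemma set_attach_uniformE:
  assumes "H \<in> set_pmf (attach_uniform x y)"
  obtains G C v where "finite_rooted_graph G" "x = abs_graph_class G"
    "finite_rooted_graph C" "y = abs_graph_class C" "v \<in> vertices G"
    "finite_rooted_graph (attach G C v)" "H = abs_graph_class (attach G C v)"
proof -
  obtain G C where GC: "finite_rooted_graph G" "x = abs_graph_class G"
    "finite_rooted_graph C" "y = abs_graph_class C"
    using graph_class_cases by metis
  then have "attach_uniform x y =
      map_pmf (\<lambda>v. abs_graph_class (attach G C v)) (pmf_of_set (vertices G))"
    by (simp add: attach_uniform.abs_eq isomorphic_refl_iff)
  moreover have "finite (vertices G)" "vertices G \<noteq> {}"
    using GC by (auto simp: finite_rooted_graph_def)
  ultimately show ?thesis
    using that GC finite_rooted_graph_attach assms by auto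
qed

lemma num_vertices_attach_uniform:
  assumes "H \<in> set_pmf (attach_uniform x y)"
  shows "num_vertices H = num_vertices x + num_vertices y"
  using assms
proof (rule set_attach_uniformE)
  fix G C v
  assume *: "finite_rooted_graph G" "x = abs_graph_class G"
    "finite_rooted_graph C" "y = abs_graph_class C" "v \<in> vertices G"
    "finite_rooted_graph (attach G C v)" "H = abs_graph_class (attach G C v)"
  have "card (vertices (attach G C v)) = card (vertices G) + card (vertices C)"
    using * unfolding vertices_attach finite_rooted_graph_def
    by (subst card_Un_disjoint)
       (auto simp: card_image inj_on_subset[OF inj_old_new(1)] inj_on_subset[OF inj_old_new(2)])
  then show ?thesis using * by (simp add: num_vertices.abs_eq isomorphic_refl_iff)
qed

lemma attach_uniform_tree:
  assumes "H \<in> set_pmf (attach_uniform x y)" "x \<in> rooted_trees" "y \<in> rooted_trees"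
  shows "H \<in> rooted_trees"
  using assms(1)
proof (rule set_attach_uniformE)
  fix G C v
  assume *: "finite_rooted_graph G" "x = abs_graph_class G"
    "finite_rooted_graph C" "y = abs_graph_class C" "v \<in> vertices G"
    "finite_rooted_graph (attach G C v)" "H = abs_graph_class (attach G C v)"
  then show ?thesis using assms(2,3) tree_attach[of G C v]
    by (simp add: rooted_trees_def is_tree.abs_eq isomorphic_refl_iff finite_rooted_graph_def)
qed

lemma singleton_graph_tree: "singleton_graph \<in> rooted_trees"
proof -
  have "\<not> cycle (Rooted_Graph {0} {} 0) c" for c :: "nat list"
    by (auto simp: cycle_def adjacent_def intro!: exI[of _ 0])
  then have "tree (Rooted_Graph {0::nat} {} 0)"
    by (simp add: tree_def connected_graph_def)
  then show ?thesis
    by (simp add: rooted_trees_def is_tree.abs_eq singleton_graph_def isomorphic_refl_iff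
        finite_rooted_graph_def)
qed

lemma num_vertices_singleton [simp]: "num_vertices singleton_graph = 1"
  by (simp add: num_vertices.abs_eq singleton_graph_def isomorphic_refl_iff finite_rooted_graph_def)

section \<open>The merging fixed point\<close>

lemma num_vertices_jump:
  assumes "H \<in> set_pmf (jump W G)"
  shows "num_vertices G < num_vertices H"
  using assms num_vertices_pos by (auto simp: jump_def num_vertices_attach_uniform)

text \<open>The law of the graph obtained by choosing a uniform vertex of the disjoint union of \<open>G\<close> and \<open>C\<close> and
  joining it to the root of the component that does not contain it; the other root becomes the root.\<close>

definition merge_graphs :: "graph_class \<Rightarrow> graph_class \<Rightarrow> graph_class pmf" where
  "merge_graphs G C = bind_pmf (bernoulli_pmf (num_vertices G / (num_vertices G + num_vertices C)))
     (\<lambda>b. if b then attach_uniform G C else attach_uniform C G)"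

definition merge_pair :: "graph_class pmf \<Rightarrow> graph_class pmf" where
  "merge_pair W = bind_pmf W (\<lambda>G. bind_pmf W (\<lambda>C. merge_graphs G C))"

text \<open>Stationary environments turn out to be the fixed points of this map.\<close>

definition merge_law :: "graph_class pmf \<Rightarrow> graph_class pmf" where
  "merge_law W = bind_pmf (bernoulli_pmf (1/2))
     (\<lambda>b. if b then return_pmf singleton_graph else merge_pair W)"

lemma num_vertices_merge:
  "H \<in> set_pmf (merge_graphs G C) \<Longrightarrow> num_vertices H = num_vertices G + num_vertices C"
  by (auto simp: merge_graphs_def num_vertices_attach_uniform split: if_splits)

lemma pmf_merge_law:
  "pmf (merge_law W) G = (if G = singleton_graph then 1/2 else 0) + pmf (merge_pair W) G / 2"
  by (simp add: merge_law_def pmf_bind indicator_def)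

text \<open>The value of the critical binary branching tree, as a least fixed point among subprobability
  laws; the argument is a dummy.\<close>

partial_function (spmf) random_merging :: "unit \<Rightarrow> graph_class spmf" where
  "random_merging u = bind_pmf (bernoulli_pmf (1/2)) (\<lambda>b.
     if b then return_spmf singleton_graph
     else bind_spmf (random_merging ()) (\<lambda>G. bind_spmf (random_merging ()) (\<lambda>C.
       spmf_of_pmf (merge_graphs G C))))"

text \<open>The total mass \<open>w\<close> satisfies \<open>w = 1/2 + w\<^sup>2 / 2\<close>, and 1 is a double root: this is the almost sure
  extinction of a critical branching process.\<close>

lemma lossless_random_merging: "lossless_spmf (random_merging ())"
proof -
  define M where "M = random_merging ()"
  have M: "M = bind_spmf (spmf_of_pmf (bernoulli_pmf (1/2))) (\<lambda>b.
     if b then return_spmf singleton_graph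
     else bind_spmf M (\<lambda>G. bind_spmf M (\<lambda>C. spmf_of_pmf (merge_graphs G C))))"
    unfolding M_def by (subst random_merging.simps) simp
  have pair: "weight_spmf (bind_spmf M (\<lambda>G. bind_spmf M (\<lambda>C. spmf_of_pmf (merge_graphs G C)))) =
      (weight_spmf M)\<^sup>2"
    by (simp add: weight_bind_spmf o_def power2_eq_square flip: weight_spmf_def)
  have "weight_spmf M = 1/2 + (weight_spmf M)\<^sup>2 / 2"
    using arg_cong[OF M, of weight_spmf] unfolding weight_bind_spmf[of "spmf_of_pmf _"]
    by (simp add: pair)
  then have "(weight_spmf M - 1)\<^sup>2 = 0" by (simp add: power2_eq_square field_simps)
  then show ?thesis by (simp add: lossless_spmf_def M_def)
qed

lemma merge_law_fixpoint_exists: "\<exists>W. merge_law W = W"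
proof -
  obtain W where W: "random_merging () = spmf_of_pmf W"
    using lossless_random_merging by (auto simp: lossless_spmf_conv_spmf_of_pmf)
  have "spmf_of_pmf W = spmf_of_pmf (merge_law W)"
    unfolding W[symmetric]
    by (subst random_merging.simps)
       (simp add: W merge_law_def merge_pair_def spmf_of_pmf_bind if_distrib cong: if_cong)
  then show ?thesis by (metis spmf_spmf_of_pmf pmf_eqI)
qed

text \<open>At \<open>H\<close> the fixed point equation involves only pairs of graphs that are both smaller than \<open>H\<close>, so it
  determines the law recursively.\<close>

lemma merge_law_fixpoint_unique:
  assumes "merge_law V = V" "merge_law W = W"
  shows "V = W"
proof (rule pmf_eqI)
  fix H
  show "pmf V H = pmf W H"
  proof (induction H rule: measure_induct_rule[where f = num_vertices])
    case (less H)
    have smaller: "pmf V G = pmf W G" if "num_vertices G < num_vertices H" for G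
      using less that .
    have zero: "pmf (merge_graphs G C) H = 0"
      if "\<not> (num_vertices G < num_vertices H \<and> num_vertices C < num_vertices H)" for G C
      using that num_vertices_merge[of H G C] num_vertices_pos[of G] num_vertices_pos[of C]
      unfolding set_pmf_iff by linarith
    have int: "(\<integral>\<^sup>+G. f G \<partial>V) = (\<integral>\<^sup>+G. f G \<partial>W)"
      if "\<And>G. \<not> num_vertices G < num_vertices H \<Longrightarrow> f G = 0" for f
      unfolding nn_integral_measure_pmf using that smaller
      by (intro nn_integral_cong) (metis mult_zero_right)
    have inner: "(\<integral>\<^sup>+C. pmf (merge_graphs G C) H \<partial>V) = (\<integral>\<^sup>+C. pmf (merge_graphs G C) H \<partial>W)" for G
      using zero by (intro int) auto
    have "ennreal (pmf (merge_pair V) H) = (\<integral>\<^sup>+G. \<integral>\<^sup>+C. pmf (merge_graphs G C) H \<partial>V \<partial>V)"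
      by (simp add: merge_pair_def ennreal_pmf_bind)
    also have "\<dots> = (\<integral>\<^sup>+G. \<integral>\<^sup>+C. pmf (merge_graphs G C) H \<partial>W \<partial>W)"
      unfolding inner using zero by (intro int) auto
    also have "\<dots> = ennreal (pmf (merge_pair W) H)"
      by (simp add: merge_pair_def ennreal_pmf_bind)
    finally have "pmf (merge_pair V) H = pmf (merge_pair W) H" by simp
    then have "pmf (merge_law V) H = pmf (merge_law W) H" by (simp add: pmf_merge_law)
    then show ?case by (simp add: assms)
  qed
qed

lemma merge_law_fixpoint_trees:
  assumes "merge_law W = W"
  shows "set_pmf W \<subseteq> rooted_trees"
proof
  fix H
  assume "H \<in> set_pmf W"
  then show "H \<in> rooted_trees"
  proof (induction H rule: measure_induct_rule[where f = num_vertices])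
    case (less H)
    have "H \<in> set_pmf (merge_law W)" using less.prems by (simp add: assms)
    then consider "H = singleton_graph"
      | G C where "G \<in> set_pmf W" "C \<in> set_pmf W" "H \<in> set_pmf (merge_graphs G C)"
      by (auto simp: merge_law_def merge_pair_def split: if_splits)
    then show ?case
    proof cases
      case 1
      then show ?thesis by (simp add: singleton_graph_tree)
    next
      case 2
      have "G \<in> rooted_trees" "C \<in> rooted_trees"
        using less.IH 2 num_vertices_merge[OF 2(3)] num_vertices_pos[of G] num_vertices_pos[of C]
        by auto
      then show ?thesis
        using 2(3) by (auto simp: merge_graphs_def split: if_splits intro: attach_uniform_tree)
    qed
  qed
qed

text \<open>Both sides are multiplied by \<open>(k - 1/2) / (k + 1)\<close> when \<open>k\<close> is increased by 1.\<close>

lemma gbinomial_half_closed_form: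
  assumes "k \<ge> 1"
  shows "(-1) ^ k * ((1/2 :: real) gchoose k) =
    - (2 / real k * real ((2 * k - 2) choose (k - 1)) / 4 ^ k)"
  using assms
proof (induction k rule: dec_induct)
  case base
  show ?case by simp
next
  case (step k)
  obtain m where m: "k = Suc m" using step by (cases k) auto
  have rec: "real (Suc k) * (1/2 gchoose Suc k) = (1/2 - real k) * (1/2 gchoose k)"
    using gbinomial_absorb_comp[of "1/2::real" k] gbinomial_absorption[of k "1/2::real"] by simp
  have "Suc m * ((2 * Suc m) choose Suc m) = 2 * (2 * m + 1) * ((2 * m) choose m)"
  proof -
    have "Suc m * ((2 * Suc m) choose Suc m) = (2 * Suc m) * ((2 * m + 1) choose m)"
      using Suc_times_binomial[of m "2 * m + 1"] by (simp del: binomial_Suc_Suc)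
    moreover have "Suc m * ((2 * m + 1) choose m) = (2 * m + 1) * ((2 * m) choose m)"
      using Suc_times_binomial[of m "2*m"] binomial_symmetric[of m "2*m+1"]
      by (simp del: binomial_Suc_Suc)
    ultimately show ?thesis by (metis mult.assoc mult.commute mult_2)
  qed
  then have "real (Suc m * ((2 * Suc m) choose Suc m)) = real (2 * (2 * m + 1) * ((2 * m) choose m))"
    by (rule arg_cong)
  then have cb: "(real m + 1) * real ((2 * m + 2) choose Suc m) =
      2 * (2 * real m + 1) * real ((2 * m) choose m)"
    by (simp del: binomial_Suc_Suc add: algebra_simps)
  have "(-1) ^ Suc k * ((1/2 :: real) gchoose Suc k) =
      (real k - 1/2) / (real k + 1) * ((-1) ^ k * ((1/2 :: real) gchoose k))"
  proof -
    have "(1/2 gchoose Suc k) = (1/2 - real k) / (real k + 1) * ((1/2 :: real) gchoose k)"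
      using rec by (simp add: field_simps)
    moreover have "(1/2 - real k) / (real k + 1) = - ((real k - 1/2) / (real k + 1))"
      unfolding minus_divide_left by simp
    ultimately show ?thesis by simp
  qed
  also have "\<dots> = - ((real k - 1/2) / (real k + 1) * (2 / real k * real ((2 * m) choose m) / 4 ^ k))"
    using step m by simp
  also have "\<dots> = - (2 / (real k + 1) * (2 * (2 * real m + 1) * real ((2 * m) choose m)) / (real m + 1) / 4 ^ Suc k)"
  proof -
    have "(x + 1/2) / (x + 2) * (2 / (x + 1) * y / z) =
        2 / (x + 2) * (2 * (2 * x + 1) * y) / (x + 1) / (4 * z)"
      if "x \<ge> 0" "z > 0" for x y z :: real
      using that by (simp add: divide_simps) (simp add: algebra_simps)
    from this[of "real m" "4 ^ k" "real ((2 * m) choose m)"] show ?thesis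
      by (simp add: m algebra_simps)
  qed
  also have "\<dots> = - (2 / (real k + 1) * real ((2 * m + 2) choose Suc m) / 4 ^ Suc k)"
    unfolding cb[symmetric] by (simp del: binomial_Suc_Suc)
  also have "\<dots> = - (2 / real (Suc k) * real ((2 * Suc k - 2) choose (Suc k - 1)) / 4 ^ Suc k)"
    by (simp add: m add.commute del: binomial_Suc_Suc)
  finally show ?case .
qed

text \<open>The \<open>- a k\<close> are the coefficients of \<open>(1 - s)\<^bsup>1/2\<^esup>\<close>, including \<open>- a 0 = 1\<close>.  The square of this series
  is \<open>1 - s\<close>, and the two terms of the convolution with an index 0 supply \<open>- 2 a k\<close>.\<close>

lemma half_binomial_convolution:
  fixes a :: "nat \<Rightarrow> real"
  defines "a \<equiv> \<lambda>k. - ((-1) ^ k * ((1/2) gchoose k))"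
  assumes "k \<ge> 1"
  shows "a k = (if k = 1 then 1/2 else 0) + (\<Sum>i\<in>{1..<k}. a i * a (k - i)) / 2"
proof -
  have "(\<Sum>i=0..k. a i * a (k - i)) = (-1) ^ k * (\<Sum>i=0..k. ((1/2) gchoose i) * ((1/2) gchoose (k - i)))"
    unfolding a_def sum_distrib_left
    by (intro sum.cong) (auto simp: power_add[symmetric])
  also have "\<dots> = (-1) ^ k * (1 gchoose k)"
    by (simp add: gbinomial_Vandermonde)
  also have "\<dots> = (if k = 1 then -1 else 0)"
    using assms(2) binomial_gbinomial[of 1 k, where 'a = real] by (auto simp: binomial_eq_0)
  finally have "(\<Sum>i=0..k. a i * a (k - i)) = (if k = 1 then -1 else 0)" .
  moreover have "{0..k} = insert 0 (insert k {1..<k})" using assms(2) by auto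
  ultimately have "a 0 * a k + (a k * a 0 + (\<Sum>i\<in>{1..<k}. a i * a (k - i))) = (if k = 1 then -1 else 0)"
    using assms(2) by simp
  moreover have "a 0 = -1" by (simp add: a_def)
  ultimately show ?thesis by (auto split: if_splits)
qed

text \<open>Merging adds sizes, so the law \<open>q\<close> of the size solves \<open>q = \<delta>\<^sub>1/2 + (q * q)/2\<close>, a convolution
  equation.\<close>

lemma merge_law_fixpoint_size_recursion:
  fixes W :: "graph_class pmf"
  assumes "merge_law W = W"
  defines "q \<equiv> map_pmf num_vertices W"
  shows "pmf q k = (if k = 1 then 1/2 else 0) + (\<Sum>i\<in>{1..<k}. pmf q i * pmf q (k - i)) / 2"
proof -
  have q0: "pmf q 0 = 0"
    using num_vertices_pos by (auto simp: q_def pmf_eq_0_set_pmf) (metis less_irrefl)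
  have merge_graphs: "map_pmf num_vertices (merge_graphs G C) = return_pmf (num_vertices G + num_vertices C)" for G C
  proof -
    have "map_pmf num_vertices (merge_graphs G C) = map_pmf (\<lambda>_. num_vertices G + num_vertices C) (merge_graphs G C)"
      by (intro map_pmf_cong) (auto simp: num_vertices_merge)
    then show ?thesis by simp
  qed
  have pair: "map_pmf num_vertices (merge_pair W) = bind_pmf q (\<lambda>i. map_pmf ((+) i) q)"
    by (simp add: merge_pair_def map_bind_pmf merge_graphs q_def bind_map_pmf pmf.map_comp o_def flip: map_pmf_def)
  have shift: "pmf (map_pmf ((+) i) q) k = (if i \<le> k then pmf q (k - i) else 0)" for i
  proof (cases "i \<le> k")
    case True
    then show ?thesis using pmf_map_inj'[of "(+) i" q "k - i"] by simp
  next
    case False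
    then show ?thesis by (auto simp: pmf_eq_0_set_pmf)
  qed
  have "q = map_pmf num_vertices (merge_law W)" by (simp add: assms)
  also have "\<dots> = bind_pmf (bernoulli_pmf (1/2))
      (\<lambda>b. if b then return_pmf 1 else bind_pmf q (\<lambda>i. map_pmf ((+) i) q))"
    by (simp add: merge_law_def map_bind_pmf pair[symmetric] if_distrib cong: if_cong)
  finally have "pmf q k = pmf \<dots> k" by (rule arg_cong)
  also have "\<dots> = (if k = 1 then 1/2 else 0) + pmf (bind_pmf q (\<lambda>i. map_pmf ((+) i) q)) k / 2"
    by (simp add: pmf_bind[of "bernoulli_pmf _"] indicator_def)
  also have "pmf (bind_pmf q (\<lambda>i. map_pmf ((+) i) q)) k = (\<Sum>i\<in>{..k}. pmf q i * pmf q (k - i))"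
    unfolding pmf_bind shift by (subst integral_measure_pmf[of "{..k}"]) (auto split: if_splits)
  also have "(\<Sum>i\<in>{..k}. pmf q i * pmf q (k - i)) = (\<Sum>i\<in>{1..<k}. pmf q i * pmf q (k - i))"
  proof (rule sum.mono_neutral_right)
    show "\<forall>i\<in>{..k} - {1..<k}. pmf q i * pmf q (k - i) = 0"
    proof
      fix i assume "i \<in> {..k} - {1..<k}"
      then have "i = 0 \<or> i = k" by auto
      then show "pmf q i * pmf q (k - i) = 0" using q0 by auto
    qed
  qed auto
  finally show ?thesis .
qed

lemma merge_law_fixpoint_sizes:
  assumes W: "merge_law W = W" and "k \<ge> 1"
  shows "measure_pmf.prob W {G. num_vertices G = k} =
    2 / real k * real ((2 * k - 2) choose (k - 1)) / 4 ^ k"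
proof -
  define q where "q = map_pmf num_vertices W"
  define a :: "nat \<Rightarrow> real" where "a k = - ((-1) ^ k * ((1/2) gchoose k))" for k
  have "pmf q k = a k" using \<open>k \<ge> 1\<close>
  proof (induction k rule: less_induct)
    case (less k)
    have "(\<Sum>i\<in>{1..<k}. pmf q i * pmf q (k - i)) = (\<Sum>i\<in>{1..<k}. a i * a (k - i))"
      using less by (intro sum.cong) auto
    then show ?case
      using half_binomial_convolution[OF less.prems] merge_law_fixpoint_size_recursion[OF W, of k]
      by (simp add: q_def a_def)
  qed
  also have "a k = 2 / real k * real ((2 * k - 2) choose (k - 1)) / 4 ^ k"
    using gbinomial_half_closed_form[OF \<open>k \<ge> 1\<close>] by (simp add: a_def)
  finally show ?thesis by (simp add: q_def pmf_map vimage_def)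
qed

section \<open>The renewal equation\<close>

lemma nn_integral_pmf_swap:
  "(\<integral>\<^sup>+x. \<integral>\<^sup>+y. f x y \<partial>measure_pmf q \<partial>measure_pmf p) = (\<integral>\<^sup>+y. \<integral>\<^sup>+x. f x y \<partial>measure_pmf p \<partial>measure_pmf q)"
proof -
  have "(\<integral>\<^sup>+x. \<integral>\<^sup>+y. f x y \<partial>measure_pmf q \<partial>measure_pmf p) = (\<integral>\<^sup>+z. f (fst z) (snd z) \<partial>pair_pmf p q)"
    by (simp add: nn_integral_pair_pmf')
  also have "\<dots> = (\<integral>\<^sup>+z. f (snd z) (fst z) \<partial>pair_pmf q p)"
    by (subst pair_commute_pmf) (simp add: case_prod_unfold)
  also have "\<dots> = (\<integral>\<^sup>+y. \<integral>\<^sup>+x. f x y \<partial>measure_pmf p \<partial>measure_pmf q)"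
    by (simp add: nn_integral_pair_pmf')
  finally show ?thesis .
qed

text \<open>In matrix notation \<open>v = \<delta> + v J\<close>, with \<open>\<delta>\<close> the point mass at the singleton and \<open>J\<close> the jump kernel.\<close>

definition satisfies_renewal :: "graph_class pmf \<Rightarrow> (graph_class \<Rightarrow> ennreal) \<Rightarrow> bool" where
  "satisfies_renewal W v \<longleftrightarrow> (\<forall>H. v H = (if H = singleton_graph then 1 else 0) +
     (\<integral>\<^sup>+G. v G * ennreal (pmf (jump W G) H) \<partial>count_space UNIV))"

text \<open>The kernel leads to strictly larger graphs only, so the equation computes \<open>v H\<close> from the values of \<open>v\<close>
  at smaller graphs.\<close>

lemma satisfies_renewal_unique:
  assumes u: "satisfies_renewal W u" and v: "satisfies_renewal W v"
  shows "u = v"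
proof
  fix H
  show "u H = v H"
  proof (induction H rule: measure_induct_rule[where f = num_vertices])
    case (less H)
    have eq: "u G * ennreal (pmf (jump W G) H) = v G * ennreal (pmf (jump W G) H)" for G
    proof (cases "H \<in> set_pmf (jump W G)")
      case True
      then show ?thesis using less num_vertices_jump by simp
    next
      case False
      then show ?thesis by (simp add: set_pmf_iff)
    qed
    have "u H = (if H = singleton_graph then 1 else 0) +
        (\<integral>\<^sup>+G. u G * ennreal (pmf (jump W G) H) \<partial>count_space UNIV)"
      using u unfolding satisfies_renewal_def by blast
    also have "\<dots> = v H"
      unfolding eq using v unfolding satisfies_renewal_def by metis
    finally show ?case .
  qed
qed

text \<open>If attaching \<open>C\<close> to \<open>G\<close> can give \<open>H\<close>, then \<open>\<bar>H\<bar> = \<bar>G\<bar> + \<bar>C\<bar>\<close>.  Hence \<open>\<bar>H\<bar>\<close> cancels the denominators in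
  the law of the merger, whose two cases have equal expectation because \<open>G\<close> and \<open>C\<close> are independent
  with the same law.\<close>

lemma size_weighted_jump:
  "(\<integral>\<^sup>+G. ennreal (num_vertices G) * ennreal (pmf (jump W G) H) \<partial>measure_pmf W) =
    ennreal (num_vertices H / 2) * ennreal (pmf (merge_pair W) H)"
proof -
  define a where "a G C = ennreal (pmf (attach_uniform G C) H)" for G C
  have m: "ennreal (num_vertices H) * ennreal (pmf (merge_graphs G C) H) =
      ennreal (num_vertices G) * a G C + ennreal (num_vertices C) * a C G" for G C
  proof -
    let ?s = "real (num_vertices G) + real (num_vertices C)"
    have s: "?s > 0" using num_vertices_pos[of G] by simp
    have p: "num_vertices G / ?s \<le> 1" "1 - num_vertices G / ?s = num_vertices C / ?s"
      using s by (simp_all add: field_simps)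
    have *: "num_vertices H * x = ?s * x"
      if "x = pmf (attach_uniform G C) H \<or> x = pmf (attach_uniform C G) H" for x :: real
    proof (cases "x = 0")
      case False
      then have "H \<in> set_pmf (attach_uniform G C) \<or> H \<in> set_pmf (attach_uniform C G)"
        using that by (auto simp: set_pmf_iff)
      then have "num_vertices H = num_vertices G + num_vertices C"
        using num_vertices_attach_uniform[of H] by auto
      then show ?thesis by simp
    qed simp
    have "pmf (merge_graphs G C) H = num_vertices G / ?s * pmf (attach_uniform G C) H +
        num_vertices C / ?s * pmf (attach_uniform C G) H"
      using p by (simp add: merge_graphs_def pmf_bind mult.commute)
    also have "num_vertices H * \<dots> = num_vertices G / ?s * (num_vertices H * pmf (attach_uniform G C) H) +
        num_vertices C / ?s * (num_vertices H * pmf (attach_uniform C G) H)"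
      by (simp add: algebra_simps)
    also have "\<dots> = num_vertices G * pmf (attach_uniform G C) H +
        num_vertices C * pmf (attach_uniform C G) H"
      using s by (simp add: *)
    finally show ?thesis
      by (simp add: a_def ennreal_mult'[symmetric] ennreal_plus[symmetric] del: ennreal_plus)
  qed
  define J where "J = (\<integral>\<^sup>+G. \<integral>\<^sup>+C. ennreal (num_vertices G) * a G C \<partial>measure_pmf W \<partial>measure_pmf W)"
  have "(\<integral>\<^sup>+G. ennreal (num_vertices G) * ennreal (pmf (jump W G) H) \<partial>measure_pmf W) = J"
    unfolding J_def a_def by (simp add: jump_def ennreal_pmf_bind nn_integral_cmult)
  moreover have "ennreal (num_vertices H) * ennreal (pmf (merge_pair W) H) = J + J"
  proof -
    have "ennreal (num_vertices H) * ennreal (pmf (merge_pair W) H) =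
        (\<integral>\<^sup>+G. \<integral>\<^sup>+C. ennreal (num_vertices H) * ennreal (pmf (merge_graphs G C) H) \<partial>measure_pmf W \<partial>measure_pmf W)"
      by (simp add: merge_pair_def ennreal_pmf_bind nn_integral_cmult)
    also have "\<dots> = J + (\<integral>\<^sup>+G. \<integral>\<^sup>+C. ennreal (num_vertices C) * a C G \<partial>measure_pmf W \<partial>measure_pmf W)"
      unfolding m J_def by (simp add: nn_integral_add)
    also have "(\<integral>\<^sup>+G. \<integral>\<^sup>+C. ennreal (num_vertices C) * a C G \<partial>measure_pmf W \<partial>measure_pmf W) = J"
      unfolding J_def by (rule nn_integral_pmf_swap)
    finally show ?thesis .
  qed
  moreover have "ennreal (1/2) * (J + J) = J"
  proof -
    have "ennreal (1/2) * (J + J) = (ennreal (1/2) + ennreal (1/2)) * J"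
      by (simp only: distrib_left distrib_right)
    also have "ennreal (1/2) + ennreal (1/2) = 1"
      by (subst ennreal_plus[symmetric]) auto
    finally show ?thesis by simp
  qed
  moreover have "ennreal (num_vertices H / 2) = ennreal (1/2) * ennreal (num_vertices H)"
    by (subst ennreal_mult'[symmetric]) auto
  ultimately show ?thesis by (simp only: mult.assoc)
qed

lemma renewal_of_size_biased:
  "(\<integral>\<^sup>+G. (c * ennreal (num_vertices G) * ennreal (pmf W G)) * ennreal (pmf (jump W G) H) \<partial>count_space UNIV) =
    c * (ennreal (num_vertices H / 2) * ennreal (pmf (merge_pair W) H))"
proof -
  have "(\<integral>\<^sup>+G. (c * ennreal (num_vertices G) * ennreal (pmf W G)) * ennreal (pmf (jump W G) H) \<partial>count_space UNIV) =
      c * (\<integral>\<^sup>+G. ennreal (num_vertices G) * ennreal (pmf (jump W G) H) \<partial>measure_pmf W)"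
    by (simp add: nn_integral_measure_pmf nn_integral_cmult[symmetric] mult_ac)
  then show ?thesis by (simp only: size_weighted_jump)
qed

text \<open>The factor 2 anticipates the mean lifetime of a stationary environment.\<close>

lemma merge_law_fixpoint_imp_renewal:
  assumes "merge_law W = W"
  shows "satisfies_renewal W (\<lambda>G. 2 * ennreal (num_vertices G) * ennreal (pmf W G))"
  unfolding satisfies_renewal_def
proof
  fix H
  have "num_vertices H * (2 * pmf W H) = (if H = singleton_graph then 1 else 0) +
      num_vertices H * pmf (merge_pair W) H"
    using pmf_merge_law[of W H] by (auto simp: assms algebra_simps)
  moreover have "2 * ennreal (num_vertices H) * ennreal (pmf W H) = ennreal (num_vertices H * (2 * pmf W H))"
    by (simp add: ennreal_mult' mult_ac)
  moreover have "2 * (ennreal (num_vertices H / 2) * ennreal (pmf (merge_pair W) H)) =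
      ennreal (num_vertices H * pmf (merge_pair W) H)"
    by (simp add: ennreal_mult'[symmetric] flip: ennreal_numeral)
  ultimately show "2 * ennreal (num_vertices H) * ennreal (pmf W H) =
      (if H = singleton_graph then 1 else 0) +
      (\<integral>\<^sup>+G. 2 * ennreal (num_vertices G) * ennreal (pmf W G) * ennreal (pmf (jump W G) H) \<partial>count_space UNIV)"
    unfolding renewal_of_size_biased by simp
qed

text \<open>Division of the renewal equation by \<open>\<bar>H\<bar>\<close> leaves \<open>c W(H) = \<delta>(H) + (c/2) M(H)\<close>, where \<open>M\<close> is the law
  of the merger of two samples of \<open>W\<close>.  Both \<open>W\<close> and \<open>M\<close> have mass 1, which forces \<open>c = 2\<close>.\<close>

lemma renewal_imp_merge_law_fixpoint:
  assumes "c < \<infinity>"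
    and renewal: "satisfies_renewal W (\<lambda>G. c * ennreal (num_vertices G) * ennreal (pmf W G))"
  shows "merge_law W = W"
proof -
  obtain r where r: "c = ennreal r" "r \<ge> 0" using assms(1) by (cases c) auto
  have eq: "r * pmf W H = (if H = singleton_graph then 1 else 0) + r / 2 * pmf (merge_pair W) H" for H
  proof -
    have "c * ennreal (num_vertices H) * ennreal (pmf W H) = (if H = singleton_graph then 1 else 0) +
        c * (ennreal (num_vertices H / 2) * ennreal (pmf (merge_pair W) H))"
      using renewal unfolding satisfies_renewal_def renewal_of_size_biased by blast
    moreover have "c * (ennreal (n / 2) * ennreal (pmf p H)) = ennreal (r * (n / 2 * pmf p H))"
      if "n \<ge> 0" for p and n :: real
      using r that by (simp add: ennreal_mult'[symmetric] del: ennreal_divide_numeral)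
    ultimately have "ennreal (r * num_vertices H * pmf W H) = ennreal ((if H = singleton_graph then 1 else 0) +
        r * (num_vertices H / 2 * pmf (merge_pair W) H))"
      using r by (simp add: ennreal_mult')
    then have "r * num_vertices H * pmf W H = (if H = singleton_graph then 1 else 0) +
        r * (num_vertices H / 2 * pmf (merge_pair W) H)"
      using r by (subst (asm) ennreal_inj) auto
    then have "num_vertices H * (r * pmf W H) = num_vertices H *
        ((if H = singleton_graph then 1 else 0) + r / 2 * pmf (merge_pair W) H)"
      by (auto simp: algebra_simps)
    then show ?thesis using num_vertices_pos[of H] by simp
  qed
  have "ennreal r = (\<integral>\<^sup>+H. ennreal (r * pmf W H) \<partial>count_space UNIV)"
    using r by (simp add: ennreal_mult' nn_integral_cmult nn_integral_pmf)
  also have "\<dots> = (\<integral>\<^sup>+H. indicator {singleton_graph} H + ennreal (r / 2) * ennreal (pmf (merge_pair W) H) \<partial>count_space UNIV)"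
    using r by (intro nn_integral_cong) (auto simp: eq ennreal_mult'[symmetric])
  also have "\<dots> = ennreal (1 + r / 2)"
    using r by (simp add: nn_integral_add nn_integral_cmult nn_integral_pmf)
  finally have "r = 2" using r by (subst (asm) ennreal_inj) auto
  show ?thesis
  proof (rule pmf_eqI)
    fix H show "pmf (merge_law W) H = pmf W H"
      using eq[of H] by (auto simp: pmf_merge_law \<open>r = 2\<close>)
  qed
qed

section \<open>The law of the explosive process\<close>

abbreviation trajectory_space :: "trajectory measure" where
  "trajectory_space \<equiv> PiM UNIV (\<lambda>_. step_space)"

lemma sets_C1_law [simp, measurable_cong]: "sets (C1_law W) = sets trajectory_space"
  by (simp add: C1_law_def)

lemma space_step_space [simp]: "space step_space = UNIV"
  by (simp add: step_space_def space_pair_measure)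

lemma space_trajectory_space [simp]: "space trajectory_space = UNIV"
  by (simp add: space_PiM)

lemma space_C1_law [simp]: "space (C1_law W) = UNIV"
  using sets_eq_imp_space_eq[OF sets_C1_law] by simp

lemma measurable_fst_step [measurable]: "fst \<in> borel_measurable step_space"
  by (simp add: step_space_def)

lemma measurable_snd_step [measurable]: "snd \<in> step_space \<rightarrow>\<^sub>M count_space UNIV"
  by (simp add: step_space_def)

lemma measurable_graph_after [measurable]:
  "(\<lambda>\<omega>. graph_after \<omega> n) \<in> trajectory_space \<rightarrow>\<^sub>M count_space UNIV"
  unfolding graph_after_def by (cases n) auto

lemma measurable_jump_time [measurable]:
  "(\<lambda>\<omega>. jump_time \<omega> n) \<in> borel_measurable trajectory_space"
  unfolding jump_time_def by measurable

lemma measurable_explosion_time [measurable]: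
  "explosion_time \<in> borel_measurable trajectory_space"
  unfolding explosion_time_def[abs_def] by measurable

text \<open>The index of the current graph is a measurable function with countably many values.\<close>

lemma measurable_C1_path:
  assumes [measurable]: "X \<in> M \<rightarrow>\<^sub>M trajectory_space" "t \<in> borel_measurable M"
  shows "(\<lambda>x. C1_path (X x) (t x)) \<in> M \<rightarrow>\<^sub>M count_space UNIV"
  unfolding C1_path_def
proof (rule measurable_compose_countable[where f = "\<lambda>i x. graph_after (X x) i"])
  show "(\<lambda>x. graph_after (X x) i) \<in> M \<rightarrow>\<^sub>M count_space UNIV" for i
    by (rule measurable_compose[OF _ measurable_graph_after]) simp
  have [measurable]: "(\<lambda>x. jump_time (X x) i) \<in> borel_measurable M" for i
    by (rule measurable_compose[OF _ measurable_jump_time]) simp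
  show "(\<lambda>x. LEAST n. t x < jump_time (X x) (Suc n)) \<in> M \<rightarrow>\<^sub>M count_space UNIV"
    by measurable
qed

text \<open>This passes from the infinite process to its construction by finitely many kernel steps.\<close>

lemma C1_law_initial_segment:
  assumes g [measurable]: "g \<in> borel_measurable (PiM {0..<n} (\<lambda>_. step_space))"
  shows "(\<integral>\<^sup>+\<omega>. g (restrict \<omega> {0..<n}) \<partial>C1_law W) = (\<integral>\<^sup>+\<omega>. g \<omega> \<partial>C1.C W 0 n (\<lambda>_. undefined))"
proof -
  let ?P = "PiM {0..<n} (\<lambda>_. step_space)"
  have up_to: "C1.up_to {0..<n} = n"
  proof (rule antisym)
    show "C1.up_to {0..<n} \<le> n" by (subst C1.up_to_iff) auto
    show "n \<le> C1.up_to {0..<n}"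
      using C1.up_to[of "{0..<n}"] by auto
  qed
  have u: "(\<lambda>_. undefined) \<in> space (PiM {0..<0::nat} (\<lambda>_. step_space))" by simp
  have sets: "sets (C1.C W 0 n (\<lambda>_. undefined)) = sets ?P" using C1.sets_C[OF u] by simp
  have restr: "(\<lambda>\<omega>. restrict \<omega> {0..<n}) \<in> C1_law W \<rightarrow>\<^sub>M ?P"
    by (simp add: measurable_cong_sets[OF sets_C1_law refl] measurable_restrict_subset)
  have restr': "(\<lambda>\<omega>. restrict \<omega> {0..<n}) \<in> C1.C W 0 n (\<lambda>_. undefined) \<rightarrow>\<^sub>M ?P"
    by (simp add: measurable_cong_sets[OF sets refl] measurable_restrict_subset)
  have "(\<integral>\<^sup>+\<omega>. g (restrict \<omega> {0..<n}) \<partial>C1_law W) =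
      (\<integral>\<^sup>+\<omega>. g \<omega> \<partial>distr (C1_law W) ?P (\<lambda>\<omega>. restrict \<omega> {0..<n}))"
    using restr by (simp add: nn_integral_distr)
  also have "distr (C1_law W) ?P (\<lambda>\<omega>. restrict \<omega> {0..<n}) = C1.CI W {0..<n}"
    unfolding C1_law_def by (rule C1.distr_lim) simp
  also have "\<dots> = distr (C1.C W 0 n (\<lambda>_. undefined)) ?P (\<lambda>\<omega>. restrict \<omega> {0..<n})"
    by (simp add: C1.CI_def up_to)
  also have "(\<integral>\<^sup>+\<omega>. g \<omega> \<partial>\<dots>) = (\<integral>\<^sup>+\<omega>. g (restrict \<omega> {0..<n}) \<partial>C1.C W 0 n (\<lambda>_. undefined))"
    using restr' by (simp add: nn_integral_distr)
  also have "\<dots> = (\<integral>\<^sup>+\<omega>. g \<omega> \<partial>C1.C W 0 n (\<lambda>_. undefined))"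
    by (intro nn_integral_cong arg_cong[where f=g])
       (auto simp: C1.space_C[OF u] space_PiM intro: extensional_restrict)
  finally show ?thesis .
qed

text \<open>The Markov property at the \<open>n\<close>-th jump, for functionals of the current graph and of the next step.
  The coordinate \<open>\<omega> n\<close> is produced from the first \<open>n\<close> coordinates by the kernel \<open>step_law\<close>, and
  \<open>graph_after \<omega> n\<close> depends on these coordinates alone.\<close>

lemma C1_law_one_step:
  assumes f: "case_prod f \<in> borel_measurable (count_space UNIV \<Otimes>\<^sub>M step_space)"
  shows "(\<integral>\<^sup>+\<omega>. f (graph_after \<omega> n) (\<omega> n) \<partial>C1_law W) =
    (\<integral>\<^sup>+\<omega>. (\<integral>\<^sup>+x. f (graph_after \<omega> n) x \<partial>step_law W (graph_after \<omega> n)) \<partial>C1_law W)"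
proof -
  let ?P = "\<lambda>n::nat. PiM {0..<n} (\<lambda>_. step_space)"
  let ?C = "\<lambda>m. C1.C W 0 m (\<lambda>_. undefined)"
  have u: "(\<lambda>_. undefined) \<in> space (?P 0)" by simp
  have ga: "(\<lambda>\<omega>. graph_after \<omega> n) \<in> ?P m \<rightarrow>\<^sub>M count_space UNIV" if "n \<le> m" for m
    using that unfolding graph_after_def by (cases n) auto
  have coord: "(\<lambda>\<omega>. \<omega> n) \<in> ?P (Suc n) \<rightarrow>\<^sub>M step_space" by simp
  have g: "(\<lambda>\<omega>. f (graph_after \<omega> n) (\<omega> n)) \<in> borel_measurable (?P (Suc n))"
    using measurable_compose[OF measurable_Pair[OF ga coord] f] by simp
  have fG: "f G \<in> borel_measurable step_space" for G
    using measurable_compose[OF measurable_Pair1' f, of G] by simp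
  have h: "(\<lambda>\<omega>. \<integral>\<^sup>+x. f (graph_after \<omega> n) x \<partial>step_law W (graph_after \<omega> n)) \<in> borel_measurable (?P n)"
    by (rule measurable_compose[OF ga]) auto
  have ga_restrict: "graph_after (restrict \<omega> {0..<m}) n = graph_after \<omega> n" if "n \<le> m" for \<omega> m
    using that by (cases n) (auto simp: graph_after_def)
  have sets: "sets (?C n) = sets (?P n)" using C1.sets_C[OF u] by simp
  have "(\<integral>\<^sup>+\<omega>. f (graph_after \<omega> n) (\<omega> n) \<partial>C1_law W) =
      (\<integral>\<^sup>+\<omega>. f (graph_after \<omega> n) (\<omega> n) \<partial>?C (Suc n))"
    using C1_law_initial_segment[OF g, of W] by (simp add: ga_restrict)
  also have "\<dots> = (\<integral>\<^sup>+\<omega>. \<integral>\<^sup>+\<omega>'. f (graph_after \<omega>' n) (\<omega>' n) \<partial>C1.eP W n \<omega> \<partial>?C n)"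
    using C1.measurable_eP[of W n] g
    by (simp, subst nn_integral_bind[where B = "?P (Suc n)"])
       (simp_all add: measurable_cong_sets[OF sets refl])
  also have "\<dots> = (\<integral>\<^sup>+\<omega>. \<integral>\<^sup>+x. f (graph_after \<omega> n) x \<partial>step_law W (graph_after \<omega> n) \<partial>?C n)"
  proof (rule nn_integral_cong)
    fix \<omega> assume "\<omega> \<in> space (?C n)"
    then have "\<omega> \<in> space (?P n)" using C1.space_C[OF u] by simp
    from C1.nn_integral_eP[OF this g]
    show "(\<integral>\<^sup>+\<omega>'. f (graph_after \<omega>' n) (\<omega>' n) \<partial>C1.eP W n \<omega>) =
        (\<integral>\<^sup>+x. f (graph_after \<omega> n) x \<partial>step_law W (graph_after \<omega> n))"
      by (cases n) (simp_all add: graph_after_def)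
  qed
  also have "\<dots> = (\<integral>\<^sup>+\<omega>. (\<integral>\<^sup>+x. f (graph_after \<omega> n) x \<partial>step_law W (graph_after \<omega> n)) \<partial>C1_law W)"
    using C1_law_initial_segment[OF h, of W] by (simp add: ga_restrict)
  finally show ?thesis .
qed

section \<open>The embedded chain and expected occupation times\<close>

primrec embedded_chain :: "graph_class pmf \<Rightarrow> nat \<Rightarrow> graph_class pmf" where
  "embedded_chain W 0 = return_pmf singleton_graph"
| "embedded_chain W (Suc n) = bind_pmf (embedded_chain W n) (jump W)"

abbreviation holding_law :: "graph_class \<Rightarrow> real measure" where
  "holding_law G \<equiv> density lborel (exponential_density (real (num_vertices G)))"

lemma prob_space_holding_law: "prob_space (holding_law G)"
  using num_vertices_pos by (intro prob_space_exponential_density) simp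

lemma prob_space_C1_law: "prob_space (C1_law W)"
proof (rule prob_spaceI)
  have "prob_space (C1.C W 0 0 (\<lambda>_. undefined))"
    by (rule C1.prob_space_C) simp
  then show "emeasure (C1_law W) (space (C1_law W)) = 1"
    using C1_law_initial_segment[of "\<lambda>_. 1" 0 W] prob_space.emeasure_space_1 by fastforce
qed

lemma nn_integral_step_law:
  assumes "f \<in> borel_measurable borel" "g \<in> borel_measurable (count_space UNIV)"
  shows "(\<integral>\<^sup>+x. f (fst x) * g (snd x) \<partial>step_law W G) =
    (\<integral>\<^sup>+t. f t \<partial>holding_law G) * (\<integral>\<^sup>+H. g H \<partial>measure_pmf (jump W G))"
proof -
  note [measurable] = assms
  have "(\<integral>\<^sup>+x. f (fst x) * g (snd x) \<partial>step_law W G) =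
      (\<integral>\<^sup>+t. \<integral>\<^sup>+H. f t * g H \<partial>measure_pmf (jump W G) \<partial>holding_law G)"
    unfolding step_law_def by (subst measure_pmf.nn_integral_fst[symmetric]) auto
  then show ?thesis by (simp add: nn_integral_cmult nn_integral_multc)
qed

lemma holding_law_mean:
  "(\<integral>\<^sup>+t. ennreal t \<partial>holding_law G) = ennreal (1 / num_vertices G)"
proof -
  let ?l = "real (num_vertices G)"
  have l: "?l > 0" using num_vertices_pos by simp
  have "(\<integral>\<^sup>+t. ennreal t \<partial>holding_law G) =
      (\<integral>\<^sup>+t. ennreal (exponential_density ?l t) * ennreal t \<partial>lborel)"
    by (simp add: nn_integral_density)
  also have "\<dots> = (\<integral>\<^sup>+t. ennreal (erlang_density 0 ?l t * t ^ 1) \<partial>lborel)"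
    using l by (intro nn_integral_cong) (auto simp: ennreal_mult'[symmetric] exponential_density_def ennreal_neg)
  also have "\<dots> = ennreal (1 / ?l)"
    using nn_integral_erlang_ith_moment[OF l, of 0 1] by simp
  finally show ?thesis .
qed

lemma holding_law_positive: "emeasure (holding_law G) {..0} = 0"
proof -
  have "emeasure (holding_law G) {..0} =
      (\<integral>\<^sup>+t. ennreal (exponential_density (num_vertices G) t) * indicator {..0} t \<partial>lborel)"
    by (simp add: emeasure_density)
  also have "\<dots> = (\<integral>\<^sup>+(t::real). 0 \<partial>lborel)"
  proof (rule nn_integral_cong_AE)
    show "AE t in lborel. ennreal (exponential_density (num_vertices G) t) * indicator {..0} t = 0"
      using AE_lborel_singleton[of "0::real"]
      by eventually_elim (auto simp: exponential_density_def indicator_def)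
  qed
  finally show ?thesis by simp
qed

lemma C1_law_product_step:
  assumes [measurable]: "f \<in> borel_measurable borel"
  shows "(\<integral>\<^sup>+\<omega>. k (graph_after \<omega> n) * (f (fst (\<omega> n)) * g (snd (\<omega> n))) \<partial>C1_law W) =
    (\<integral>\<^sup>+\<omega>. k (graph_after \<omega> n) * ((\<integral>\<^sup>+t. f t \<partial>holding_law (graph_after \<omega> n)) *
       (\<integral>\<^sup>+H. g H \<partial>measure_pmf (jump W (graph_after \<omega> n)))) \<partial>C1_law W)"
proof -
  have [measurable]: "g \<in> borel_measurable (count_space UNIV)" "k \<in> borel_measurable (count_space UNIV)"
    by simp_all
  have [measurable_cong]: "sets (step_law W G) = sets step_space" for G
    by (rule sets_step_law)
  have "(\<lambda>(G, x). k G * (f (fst x) * g (snd x))) \<in> borel_measurable (count_space UNIV \<Otimes>\<^sub>M step_space)"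
    by measurable
  from C1_law_one_step[OF this] show ?thesis
    by (simp add: nn_integral_cmult nn_integral_step_law)
qed

lemma nn_integral_graph_after:
  "(\<integral>\<^sup>+\<omega>. g (graph_after \<omega> n) \<partial>C1_law W) = (\<integral>\<^sup>+G. g G \<partial>measure_pmf (embedded_chain W n))"
proof (induction n arbitrary: g)
  case 0
  interpret prob_space "C1_law W" by (rule prob_space_C1_law)
  show ?case using emeasure_space_1 by (simp add: graph_after_def)
next
  case (Suc n)
  have one: "(\<integral>\<^sup>+t. 1 \<partial>holding_law G) = 1" for G
    using prob_space.emeasure_space_1[OF prob_space_holding_law] by simp
  have "(\<integral>\<^sup>+\<omega>. g (graph_after \<omega> (Suc n)) \<partial>C1_law W) =
      (\<integral>\<^sup>+\<omega>. \<integral>\<^sup>+H. g H \<partial>measure_pmf (jump W (graph_after \<omega> n)) \<partial>C1_law W)"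
    using C1_law_product_step[of "\<lambda>_. 1" W "\<lambda>_. 1" n g]
    by (simp add: graph_after_def one del: nn_integral_const)
  then show ?case
    using Suc.IH[of "\<lambda>G. \<integral>\<^sup>+H. g H \<partial>measure_pmf (jump W G)"] by simp
qed

text \<open>Given the current graph \<open>G\<close>, the waiting time is exponential of rate \<open>\<bar>G\<bar>\<close>.\<close>

lemma nn_integral_holding_time:
  "(\<integral>\<^sup>+\<omega>. k (graph_after \<omega> n) * ennreal (fst (\<omega> n)) \<partial>C1_law W) =
    (\<integral>\<^sup>+G. k G * ennreal (1 / num_vertices G) \<partial>measure_pmf (embedded_chain W n))"
  using C1_law_product_step[of ennreal W k n "\<lambda>_. 1"]
    nn_integral_graph_after[of W "\<lambda>G. k G * ennreal (1 / real (num_vertices G))" n]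
  by (simp add: holding_law_mean)

lemma AE_holding_times_positive: "AE \<omega> in C1_law W. \<forall>n. 0 < fst (\<omega> n)"
proof (subst AE_all_countable, rule allI)
  fix n
  have "(\<integral>\<^sup>+\<omega>. indicator {..0} (fst (\<omega> n)) \<partial>C1_law W) = 0"
    using C1_law_product_step[of "indicator {..0}" W "\<lambda>_. 1" n "\<lambda>_. 1"] holding_law_positive
    by simp
  then have "AE \<omega> in C1_law W. (indicator {..0} (fst (\<omega> n)) :: ennreal) = 0"
    by (subst (asm) nn_integral_0_iff_AE) auto
  then show "AE \<omega> in C1_law W. 0 < fst (\<omega> n)"
    by eventually_elim (auto simp: indicator_def split: if_splits)
qed

lemma explosion_time_eq_suminf:
  assumes "\<And>n. 0 \<le> fst (\<omega> n)"
  shows "explosion_time \<omega> = (\<Sum>n. ennreal (fst (\<omega> n)))"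
  using assms by (simp add: explosion_time_def jump_time_def suminf_eq_SUP sum_ennreal)

text \<open>The expected number of visits to \<open>G\<close> of the embedded chain, that is, its Green function.\<close>

definition green :: "graph_class pmf \<Rightarrow> graph_class \<Rightarrow> ennreal" where
  "green W G = (\<Sum>n. ennreal (pmf (embedded_chain W n) G))"

text \<open>The first visit at time 0 accounts for the point mass; every later visit is reached by a jump.\<close>

lemma green_satisfies_renewal: "satisfies_renewal W (green W)"
  unfolding satisfies_renewal_def
proof
  fix H
  have "green W H = ennreal (pmf (embedded_chain W 0) H) + (\<Sum>n. ennreal (pmf (embedded_chain W (Suc n)) H))"
    unfolding green_def by (subst suminf_offset[where i = 1]) auto
  also have "ennreal (pmf (embedded_chain W 0) H) = (if H = singleton_graph then 1 else 0)"
    by (simp add: indicator_def)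
  also have "(\<Sum>n. ennreal (pmf (embedded_chain W (Suc n)) H)) =
      (\<Sum>n. \<integral>\<^sup>+G. ennreal (pmf (embedded_chain W n) G) * ennreal (pmf (jump W G) H) \<partial>count_space UNIV)"
    by (simp add: ennreal_pmf_bind nn_integral_measure_pmf)
  also have "\<dots> = (\<integral>\<^sup>+G. green W G * ennreal (pmf (jump W G) H) \<partial>count_space UNIV)"
    by (simp add: green_def nn_integral_suminf[symmetric])
  finally show "green W H = (if H = singleton_graph then 1 else 0) +
     (\<integral>\<^sup>+G. green W G * ennreal (pmf (jump W G) H) \<partial>count_space UNIV)" .
qed

text \<open>Each visit to \<open>G\<close> lasts \<open>1 / \<bar>G\<bar>\<close> on average.\<close>

lemma expected_occupation:
  "(\<Sum>n. \<integral>\<^sup>+\<omega>. k (graph_after \<omega> n) * ennreal (fst (\<omega> n)) \<partial>C1_law W) =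
    (\<integral>\<^sup>+G. green W G * (k G * ennreal (1 / num_vertices G)) \<partial>count_space UNIV)"
  by (simp add: nn_integral_holding_time nn_integral_measure_pmf green_def nn_integral_suminf[symmetric])

lemma expected_explosion_time:
  "(\<integral>\<^sup>+\<omega>. explosion_time \<omega> \<partial>C1_law W) =
    (\<integral>\<^sup>+G. green W G * ennreal (1 / num_vertices G) \<partial>count_space UNIV)"
proof -
  have "(\<integral>\<^sup>+\<omega>. explosion_time \<omega> \<partial>C1_law W) = (\<integral>\<^sup>+\<omega>. (\<Sum>n. ennreal (fst (\<omega> n))) \<partial>C1_law W)"
  proof (rule nn_integral_cong_AE)
    show "AE \<omega> in C1_law W. explosion_time \<omega> = (\<Sum>n. ennreal (fst (\<omega> n)))"
      using AE_holding_times_positive[of W]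
      by eventually_elim (auto simp: explosion_time_eq_suminf less_imp_le)
  qed
  also have "\<dots> = (\<Sum>n. \<integral>\<^sup>+\<omega>. ennreal (fst (\<omega> n)) \<partial>C1_law W)"
    by (rule nn_integral_suminf) measurable
  finally show ?thesis using expected_occupation[of W "\<lambda>_. 1"] by simp
qed

section \<open>Sampling a path at time zero\<close>

lemma jump_time_mono:
  assumes "\<And>n. 0 \<le> fst (\<omega> n)" "m \<le> n"
  shows "jump_time \<omega> m \<le> jump_time \<omega> n"
  using assms unfolding jump_time_def by (intro sum_mono2) auto

lemma C1_path_eq_graph_after:
  assumes "\<And>n. 0 \<le> fst (\<omega> n)" "jump_time \<omega> n \<le> t" "t < jump_time \<omega> (Suc n)"
  shows "C1_path \<omega> t = graph_after \<omega> n"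
proof -
  have "(LEAST m. t < jump_time \<omega> (Suc m)) = n"
  proof (rule Least_equality)
    show "t < jump_time \<omega> (Suc n)" by fact
    fix m assume m: "t < jump_time \<omega> (Suc m)"
    show "n \<le> m"
    proof (rule ccontr)
      assume "\<not> n \<le> m"
      then have "jump_time \<omega> (Suc m) \<le> jump_time \<omega> n" by (intro jump_time_mono assms) auto
      with m assms(2) show False by simp
    qed
  qed
  then show ?thesis by (simp add: C1_path_def)
qed

text \<open>The intervals between successive jumps exhaust the time before the explosion.\<close>

lemma before_explosion_iff:
  assumes T: "\<And>n. 0 \<le> fst (\<omega> n)"
  shows "0 \<le> t \<and> ennreal t < explosion_time \<omega> \<longleftrightarrow> (\<exists>n. jump_time \<omega> n \<le> t \<and> t < jump_time \<omega> (Suc n))"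
proof
  assume t: "0 \<le> t \<and> ennreal t < explosion_time \<omega>"
  then obtain n where "ennreal t < ennreal (jump_time \<omega> n)"
    by (auto simp: explosion_time_def less_SUP_iff)
  with t have n: "t < jump_time \<omega> n" by (simp add: ennreal_less_iff)
  define m where "m = (LEAST n. t < jump_time \<omega> n)"
  have m: "t < jump_time \<omega> m" unfolding m_def using n by (rule LeastI)
  have "jump_time \<omega> 0 \<le> t" using t by (simp add: jump_time_def)
  with m obtain k where k: "m = Suc k" by (cases m) auto
  then have "\<not> t < jump_time \<omega> k" unfolding m_def by (intro not_less_Least) auto
  with m k show "\<exists>n. jump_time \<omega> n \<le> t \<and> t < jump_time \<omega> (Suc n)"
    by (intro exI[of _ k]) auto
next
  assume "\<exists>n. jump_time \<omega> n \<le> t \<and> t < jump_time \<omega> (Suc n)"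
  then obtain n where n: "jump_time \<omega> n \<le> t" "t < jump_time \<omega> (Suc n)" by blast
  have "jump_time \<omega> 0 \<le> jump_time \<omega> n" by (intro jump_time_mono T) simp
  then have "0 \<le> t" using n by (simp add: jump_time_def)
  moreover have "ennreal t < ennreal (jump_time \<omega> (Suc n))"
    using n \<open>0 \<le> t\<close> by (simp add: ennreal_lessI)
  ultimately show "0 \<le> t \<and> ennreal t < explosion_time \<omega>"
    unfolding explosion_time_def less_SUP_iff by blast
qed

text \<open>A trajectory is at \<open>graph_after \<omega> n\<close> exactly during its \<open>n\<close>-th waiting time.\<close>

lemma occupation_time:
  assumes T: "\<And>n. 0 \<le> fst (\<omega> n)"
  shows "(\<integral>\<^sup>+t. (if 0 \<le> t \<and> ennreal t < explosion_time \<omega> then k (C1_path \<omega> t) else 0) \<partial>lborel) =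
    (\<Sum>n. k (graph_after \<omega> n) * ennreal (fst (\<omega> n)))"
proof -
  have pointwise: "(if 0 \<le> t \<and> ennreal t < explosion_time \<omega> then k (C1_path \<omega> t) else 0) =
      (\<Sum>n. k (graph_after \<omega> n) * indicator {jump_time \<omega> n ..< jump_time \<omega> (Suc n)} t)" for t
  proof (cases "\<exists>n. jump_time \<omega> n \<le> t \<and> t < jump_time \<omega> (Suc n)")
    case True
    then obtain n where n: "jump_time \<omega> n \<le> t" "t < jump_time \<omega> (Suc n)" by blast
    have "\<not> (jump_time \<omega> m \<le> t \<and> t < jump_time \<omega> (Suc m))" if "m \<noteq> n" for m
    proof (cases "m < n")
      case True
      then have "jump_time \<omega> (Suc m) \<le> jump_time \<omega> n" by (intro jump_time_mono T) auto
      with n show ?thesis by auto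
    next
      case False
      then have "jump_time \<omega> (Suc n) \<le> jump_time \<omega> m"
        using that by (intro jump_time_mono T) auto
      with n show ?thesis by auto
    qed
    then have "(\<Sum>m. k (graph_after \<omega> m) * indicator {jump_time \<omega> m ..< jump_time \<omega> (Suc m)} t) =
        (\<Sum>m\<in>{n}. k (graph_after \<omega> m) * indicator {jump_time \<omega> m ..< jump_time \<omega> (Suc m)} t)"
      by (intro suminf_finite) (auto simp: indicator_def)
    also have "\<dots> = k (C1_path \<omega> t)"
      using n C1_path_eq_graph_after[OF T n] by simp
    finally show ?thesis
      using True before_explosion_iff[where \<omega> = \<omega> and t = t, OF T] by simp
  next
    case False
    then have "indicator {jump_time \<omega> n ..< jump_time \<omega> (Suc n)} t = (0 :: ennreal)" for n
      by (auto simp: indicator_def)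
    then show ?thesis using False before_explosion_iff[where \<omega> = \<omega> and t = t, OF T] by auto
  qed
  have "(\<integral>\<^sup>+t. (if 0 \<le> t \<and> ennreal t < explosion_time \<omega> then k (C1_path \<omega> t) else 0) \<partial>lborel) =
      (\<Sum>n. \<integral>\<^sup>+t. k (graph_after \<omega> n) * indicator {jump_time \<omega> n ..< jump_time \<omega> (Suc n)} t \<partial>lborel)"
    unfolding pointwise by (rule nn_integral_suminf) simp
  also have "\<dots> = (\<Sum>n. k (graph_after \<omega> n) * ennreal (fst (\<omega> n)))"
    using T by (simp add: nn_integral_cmult_indicator jump_time_def)
  finally show ?thesis .
qed

text \<open>The right end point is dropped because relative position 1 falls into the next copy.\<close>

lemma nn_integral_uniform_unit_interval:
  fixes f :: "real \<Rightarrow> ennreal"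
  assumes [measurable]: "f \<in> borel_measurable borel"
  shows "(\<integral>\<^sup>+u. f u \<partial>uniform_measure lborel {0..1}) = (\<integral>\<^sup>+u. f u * indicator {0..<1} u \<partial>lborel)"
proof -
  have "(\<integral>\<^sup>+u. f u \<partial>uniform_measure lborel {0..1}) = (\<integral>\<^sup>+u. f u * indicator {0..1} u \<partial>lborel)"
    by (subst nn_integral_uniform_measure) (auto simp: divide_ennreal_def)
  also have "\<dots> = (\<integral>\<^sup>+u. f u * indicator {0..<1} u \<partial>lborel)"
  proof (rule nn_integral_cong_AE)
    show "AE u in lborel. f u * indicator {0..1} u = f u * indicator {0..<1} u"
      using AE_lborel_singleton[of "1::real"] by eventually_elim (auto simp: indicator_def)
  qed
  finally show ?thesis .
qed

text \<open>The lifetime that biases the choice of the copy cancels the density of the uniform time in it.\<close>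

lemma uniform_time_average:
  assumes pos: "0 < explosion_time \<omega>" and fin: "explosion_time \<omega> < \<infinity>"
  shows "explosion_time \<omega> * (\<integral>\<^sup>+u. k (C1_path \<omega> (u * lifetime \<omega>)) \<partial>uniform_measure lborel {0..1}) =
    (\<integral>\<^sup>+t. (if 0 \<le> t \<and> ennreal t < explosion_time \<omega> then k (C1_path \<omega> t) else 0) \<partial>lborel)"
proof -
  let ?l = "lifetime \<omega>"
  have L: "explosion_time \<omega> = ennreal ?l" using fin by (simp add: lifetime_def)
  have l: "?l > 0" using pos unfolding L by simp
  have [measurable]: "(\<lambda>t. C1_path \<omega> (f t)) \<in> borel \<rightarrow>\<^sub>M count_space UNIV"
    if "f \<in> borel_measurable borel" for f
    using measurable_C1_path[of "\<lambda>_. \<omega>" borel f] that by simp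
  have [measurable]: "k \<in> borel_measurable (count_space UNIV)" by simp
  have [measurable]: "(\<lambda>t. k (C1_path \<omega> (f t))) \<in> borel_measurable borel"
    if "f \<in> borel_measurable borel" for f :: "real \<Rightarrow> real"
    using that by measurable
  have "(\<integral>\<^sup>+t. (if 0 \<le> t \<and> ennreal t < explosion_time \<omega> then k (C1_path \<omega> t) else 0) \<partial>lborel) =
      ennreal \<bar>?l\<bar> * (\<integral>\<^sup>+u. (if 0 \<le> 0 + ?l * u \<and> ennreal (0 + ?l * u) < explosion_time \<omega>
        then k (C1_path \<omega> (0 + ?l * u)) else 0) \<partial>lborel)"
    using l by (intro nn_integral_real_affine) auto
  also have "(\<integral>\<^sup>+u. (if 0 \<le> 0 + ?l * u \<and> ennreal (0 + ?l * u) < explosion_time \<omega>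
        then k (C1_path \<omega> (0 + ?l * u)) else 0) \<partial>lborel) =
      (\<integral>\<^sup>+u. k (C1_path \<omega> (u * ?l)) * indicator {0..<1} u \<partial>lborel)"
    unfolding L using l
    by (intro nn_integral_cong)
       (auto simp: indicator_def ennreal_less_iff zero_le_mult_iff mult.commute)
  also have "\<dots> = (\<integral>\<^sup>+u. k (C1_path \<omega> (u * ?l)) \<partial>uniform_measure lborel {0..1})"
    by (rule nn_integral_uniform_unit_interval[symmetric]) simp
  finally show ?thesis using l L by simp
qed

lemma lifetime_nonneg: "0 \<le> lifetime \<omega>"
  by (simp add: lifetime_def)

lemma measurable_lifetime [measurable]: "lifetime \<in> borel_measurable trajectory_space"
  unfolding lifetime_def[abs_def] by measurable

abbreviation sample_space :: "(real \<times> (int \<Rightarrow> trajectory)) measure" where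
  "sample_space \<equiv> borel \<Otimes>\<^sub>M PiM UNIV (\<lambda>_. trajectory_space)"

lemma start_time_step: "start_time p (n + 1) = start_time p n + lifetime (snd p n)"
proof -
  obtain u X where p: "p = (u, X)" by (cases p)
  consider "0 \<le> n" | "n = -1" | "n < -1" by linarith
  then show ?thesis
  proof cases
    case 1
    then have "{0..<n + 1} = insert n {0..<n}" by auto
    then show ?thesis using 1 by (simp add: p start_time_def)
  next
    case 2
    then have "{n..<0} = {n}" by auto
    then show ?thesis using 2 by (simp add: p start_time_def)
  next
    case 3
    then have "{n..<0} = insert n {n + 1..<0}" by auto
    then show ?thesis using 3 by (simp add: p start_time_def)
  qed
qed

lemma start_time_mono: "m \<le> n \<Longrightarrow> start_time p m \<le> start_time p n"
  by (induction n rule: int_ge_induct) (auto simp: start_time_step intro: add_increasing2 lifetime_nonneg)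

text \<open>This holds for every sample point, because lifetimes are nonnegative.  It makes the description
  operator in \<open>stationary_process\<close> measurable also outside the event of probability 1 on which the
  intervals cover the line.\<close>

lemma interval_index_unique:
  assumes "start_time p m \<le> t" "t < start_time p (m + 1)" "start_time p n \<le> t" "t < start_time p (n + 1)"
  shows "m = n"
  using assms start_time_mono[of "m + 1" n p] start_time_mono[of "n + 1" m p] by linarith

lemma measurable_start_time [measurable]: "(\<lambda>p. start_time p n) \<in> borel_measurable sample_space"
  unfolding start_time_def case_prod_beta by measurable

lemma measurable_stationary_process:
  "(\<lambda>p. stationary_process p t) \<in> sample_space \<rightarrow>\<^sub>M count_space UNIV"
  unfolding stationary_process_def Let_def
proof (rule measurable_compose_countable[where f = "\<lambda>n p. C1_path (snd p n) (t - start_time p n)"])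
  show "(\<lambda>p. C1_path (snd p n) (t - start_time p n)) \<in> sample_space \<rightarrow>\<^sub>M count_space UNIV" for n
    by (rule measurable_C1_path) measurable
  show "(\<lambda>p. THE n. start_time p n \<le> t \<and> t < start_time p (n + 1)) \<in> sample_space \<rightarrow>\<^sub>M count_space UNIV"
    by (rule measurable_THE[where I = UNIV]) (auto dest: interval_index_unique)
qed

text \<open>The intervals are placed so that time 0 falls into copy 0.\<close>

lemma stationary_process_0:
  assumes "0 \<le> u" "u < 1" "0 < lifetime (X 0)"
  shows "stationary_process (u, X) 0 = C1_path (X 0) (u * lifetime (X 0))"
proof -
  have s: "start_time (u, X) 0 = - u * lifetime (X 0)" by (simp add: start_time_def)
  have "start_time (u, X) 0 \<le> 0" using assms by (simp add: s)
  moreover have "0 < start_time (u, X) (0 + 1)"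
    using assms unfolding start_time_step s by simp
  ultimately have "(THE n. start_time (u, X) n \<le> 0 \<and> 0 < start_time (u, X) (n + 1)) = 0"
    by (intro the_equality) (auto intro: interval_index_unique)
  then show ?thesis by (simp add: stationary_process_def s)
qed

section \<open>The one-dimensional law of the stationary process\<close>

text \<open>The prescribed measure of a cylinder is a product over its base together with all factors that are not
  probability measures.  It contains the null factor \<open>M i\<close>, so it always vanishes.\<close>

lemma PiM_null_factor:
  assumes "i \<in> I" "emeasure (M i) (space (M i)) = 0"
    and "finite {j \<in> I. emeasure (M j) (space (M j)) \<noteq> 1}"
  shows "emeasure (PiM I M) A = 0"
proof -
  let ?F = "{j \<in> I. emeasure (M j) (space (M j)) \<noteq> 1}"
  have "(\<Prod>j\<in>J \<union> ?F. if j \<in> J then emeasure (M j) (X j) else emeasure (M j) (space (M j))) = 0"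
    if "finite J" "X \<in> (\<Pi> j\<in>J. sets (M j))" for J X
  proof (rule prod_zero)
    have "emeasure (M i) (X i) = 0"
      using assms(2) emeasure_space[of "M i" "X i"] by simp
    then show "\<exists>j\<in>J \<union> ?F. (if j \<in> J then emeasure (M j) (X j) else emeasure (M j) (space (M j))) = 0"
      using assms(1,2) by (intro bexI[of _ i]) auto
  qed (use that assms(3) in auto)
  then have "PiM I M = measure_of (\<Pi>\<^sub>E i\<in>I. space (M i))
      ((\<lambda>(J, X). prod_emb I M J (Pi\<^sub>E J X)) ` {(J, X). (J \<noteq> {} \<or> I = {}) \<and> finite J \<and> J \<subseteq> I \<and> X \<in> (\<Pi> j\<in>J. sets (M j))})
      (\<lambda>_. 0)"
    unfolding PiM_def extend_measure_def by (intro if_not_P) auto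
  then show ?thesis by (simp add: emeasure_sigma)
qed

abbreviation mean_lifetime :: "graph_class pmf \<Rightarrow> ennreal" where
  "mean_lifetime W \<equiv> \<integral>\<^sup>+\<omega>. explosion_time \<omega> \<partial>C1_law W"

text \<open>The first waiting time alone has mean 1.  The bound makes division by the mean lifetime harmless.\<close>

lemma mean_lifetime_ge_1: "1 \<le> mean_lifetime W"
proof -
  have "green W singleton_graph = (if singleton_graph = singleton_graph then 1 else 0) +
      (\<integral>\<^sup>+G. green W G * ennreal (pmf (jump W G) singleton_graph) \<partial>count_space UNIV)"
    using green_satisfies_renewal[of W] unfolding satisfies_renewal_def by (rule spec)
  then have "1 \<le> green W singleton_graph"
    unfolding le_iff_add if_P[OF refl] by (rule exI)
  then have "indicator {singleton_graph} G \<le> green W G * ennreal (1 / num_vertices G)" for G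
    by (cases "G = singleton_graph") simp_all
  then have "(\<integral>\<^sup>+G. indicator {singleton_graph} G \<partial>count_space UNIV) \<le> mean_lifetime W"
    unfolding expected_explosion_time by (intro nn_integral_mono)
  then show ?thesis by simp
qed

lemma nn_integral_size_biased_law:
  assumes [measurable]: "f \<in> borel_measurable trajectory_space"
  shows "(\<integral>\<^sup>+\<omega>. f \<omega> \<partial>size_biased_law W) =
    (\<integral>\<^sup>+\<omega>. explosion_time \<omega> * f \<omega> \<partial>C1_law W) * inverse (mean_lifetime W)"
proof -
  have "(\<integral>\<^sup>+\<omega>. f \<omega> \<partial>size_biased_law W) =
      (\<integral>\<^sup>+\<omega>. explosion_time \<omega> * f \<omega> * inverse (mean_lifetime W) \<partial>C1_law W)"
    unfolding size_biased_law_def divide_ennreal_def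
    by (subst nn_integral_density) (auto simp: mult_ac)
  then show ?thesis by (simp add: nn_integral_multc)
qed

lemma sets_size_biased_law [simp, measurable_cong]:
  "sets (size_biased_law W) = sets trajectory_space"
  by (simp add: size_biased_law_def)

lemma space_size_biased_law [simp]: "space (size_biased_law W) = UNIV"
  by (simp add: size_biased_law_def)

lemma emeasure_size_biased_law:
  "emeasure (size_biased_law W) UNIV = mean_lifetime W * inverse (mean_lifetime W)"
  using nn_integral_size_biased_law[of "\<lambda>_. 1" W] by simp

lemma prob_space_size_biased_law:
  assumes "mean_lifetime W < \<infinity>"
  shows "prob_space (size_biased_law W)"
proof (rule prob_spaceI)
  have "mean_lifetime W \<noteq> 0" using mean_lifetime_ge_1[of W] by auto
  moreover have "mean_lifetime W < \<top>" using assms by simp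
  ultimately have "mean_lifetime W / mean_lifetime W = 1" by (rule ennreal_divide_self)
  then show "emeasure (size_biased_law W) (space (size_biased_law W)) = 1"
    unfolding space_size_biased_law emeasure_size_biased_law divide_ennreal_def .
qed

abbreviation copies_space :: "graph_class pmf \<Rightarrow> (int \<Rightarrow> trajectory) measure" where
  "copies_space W \<equiv> PiM UNIV (\<lambda>n. if n = 0 then size_biased_law W else C1_law W)"

lemma sets_copies_space: "sets (copies_space W) = sets (PiM UNIV (\<lambda>_. trajectory_space))"
  by (rule sets_PiM_cong) auto

lemma sets_regenerative_space: "sets (regenerative_space W) = sets sample_space"
  unfolding regenerative_space_def by (intro sets_pair_measure_cong sets_copies_space) simp

lemma measurable_stationary_process_regenerative [measurable]:
  "(\<lambda>p. stationary_process p t) \<in> regenerative_space W \<rightarrow>\<^sub>M count_space UNIV"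
  using measurable_stationary_process
  by (simp add: measurable_cong_sets[OF sets_regenerative_space refl])

lemma nn_integral_stationary_law:
  "(\<integral>\<^sup>+G. k G \<partial>stationary_law W 0) = (\<integral>\<^sup>+p. k (stationary_process p 0) \<partial>regenerative_space W)"
  unfolding stationary_law_def by (rule nn_integral_distr) auto

text \<open>Here the density of the size-biased law is \<open>explosion_time \<omega> / \<infinity> = 0\<close>.  In this way stationarity
  excludes an infinite mean lifetime.\<close>

lemma stationary_law_null:
  assumes "mean_lifetime W = \<infinity>"
  shows "emeasure (stationary_law W 0) UNIV = 0"
proof -
  have null: "emeasure (copies_space W) A = 0" for A
  proof (rule PiM_null_factor[of 0])
    have "{n::int. emeasure (if n = 0 then size_biased_law W else C1_law W)
        (space (if n = 0 then size_biased_law W else C1_law W)) \<noteq> 1} \<subseteq> {0}"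
      using prob_space.emeasure_space_1[OF prob_space_C1_law, of W] by auto
    from finite_subset[OF this]
    show "finite {n \<in> UNIV. emeasure (if n = (0::int) then size_biased_law W else C1_law W)
        (space (if n = 0 then size_biased_law W else C1_law W)) \<noteq> 1}"
      by simp
  qed (simp_all add: emeasure_size_biased_law assms)
  interpret copies: finite_measure "copies_space W"
    by (rule finite_measureI) (simp add: null)
  have "(\<integral>\<^sup>+G. 1 \<partial>stationary_law W 0) = (\<integral>\<^sup>+p. 1 \<partial>regenerative_space W)"
    by (rule nn_integral_stationary_law)
  also have "\<dots> = 0"
    unfolding regenerative_space_def by (subst copies.nn_integral_fst[symmetric]) (auto simp: null)
  finally show ?thesis by (simp add: stationary_law_def)
qed

text \<open>The integral over the position in copy 0 is, after size biasing, the time that a trajectory spends at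
  the various graphs, divided by the mean lifetime.\<close>

lemma stationary_law_formula:
  assumes fin: "mean_lifetime W < \<infinity>"
  shows "(\<integral>\<^sup>+G. k G \<partial>stationary_law W 0) =
    (\<integral>\<^sup>+G. green W G * (k G * ennreal (1 / num_vertices G)) \<partial>count_space UNIV) / mean_lifetime W"
proof -
  let ?U = "uniform_measure lborel {0..1::real}"
  let ?B = "size_biased_law W"
  let ?path = "\<lambda>\<omega> u. k (C1_path \<omega> (u * lifetime \<omega>))"
  interpret B: prob_space ?B by (rule prob_space_size_biased_law[OF fin])
  interpret C: prob_space "C1_law W" by (rule prob_space_C1_law)
  have factors: "prob_space (if n = 0 then ?B else C1_law W)" for n :: int
    using B.prob_space_axioms C.prob_space_axioms by simp
  interpret copies: prob_space "copies_space W"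
    by (rule prob_space_PiM) (rule factors)
  interpret U: prob_space ?U by (rule prob_space_uniform_measure) auto
  interpret UB: pair_sigma_finite ?U ?B ..
  have k [measurable]: "k \<in> borel_measurable (count_space UNIV)" by simp
  have path [measurable]: "(\<lambda>x. ?path (f x) (g x)) \<in> borel_measurable M"
    if [measurable]: "f \<in> M \<rightarrow>\<^sub>M trajectory_space" "g \<in> borel_measurable M" for M :: "'x measure" and f g
    by (rule measurable_compose[OF measurable_C1_path k]) measurable
  have AE_C: "AE \<omega> in C1_law W. (\<forall>n. 0 < fst (\<omega> n)) \<and> explosion_time \<omega> < \<infinity>"
    using AE_holding_times_positive[of W] nn_integral_PInf_AE[of explosion_time "C1_law W"] fin
    by (auto simp: less_top)
  have pos: "0 < explosion_time \<omega>" if "\<forall>n. 0 < fst (\<omega> n)" for \<omega>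
  proof -
    have "0 < ennreal (jump_time \<omega> 1)" using that by (simp add: jump_time_def)
    then show ?thesis unfolding explosion_time_def less_SUP_iff by blast
  qed
  have AE_B: "AE \<omega> in ?B. 0 < lifetime \<omega>"
    unfolding size_biased_law_def
  proof (subst AE_density)
    show "AE \<omega> in C1_law W. 0 < explosion_time \<omega> / mean_lifetime W \<longrightarrow> 0 < lifetime \<omega>"
      using AE_C by eventually_elim (use pos in \<open>auto simp: lifetime_def enn2real_positive_iff\<close>)
  qed measurable
  have AE_copies: "AE X in copies_space W. 0 < lifetime (X 0)"
  proof (rule AE_PiM_component)
    show "AE \<omega> in if (0::int) = 0 then ?B else C1_law W. 0 < lifetime \<omega>"
      using AE_B by simp
  qed (simp_all add: B.prob_space_axioms C.prob_space_axioms)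
  have marginal: "(\<integral>\<^sup>+X. f (X 0) \<partial>copies_space W) = (\<integral>\<^sup>+\<omega>. f \<omega> \<partial>?B)"
    if [measurable]: "f \<in> borel_measurable trajectory_space" for f :: "trajectory \<Rightarrow> ennreal"
  proof -
    have "distr (copies_space W) (if (0::int) = 0 then ?B else C1_law W) (\<lambda>X. X 0) =
        (if (0::int) = 0 then ?B else C1_law W)"
      by (rule distr_PiM_component) (use factors in auto)
    then have "(\<integral>\<^sup>+\<omega>. f \<omega> \<partial>?B) = (\<integral>\<^sup>+\<omega>. f \<omega> \<partial>distr (copies_space W) ?B (\<lambda>X. X 0))" by simp
    also have "\<dots> = (\<integral>\<^sup>+X. f (X 0) \<partial>copies_space W)"
    proof (rule nn_integral_distr)
      show "(\<lambda>X. X 0) \<in> copies_space W \<rightarrow>\<^sub>M ?B"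
        using measurable_component_singleton[of 0 UNIV "\<lambda>n. if n = (0::int) then ?B else C1_law W"] by simp
    qed simp
    finally show ?thesis by simp
  qed
  have "(\<integral>\<^sup>+G. k G \<partial>stationary_law W 0) = (\<integral>\<^sup>+p. k (stationary_process p 0) \<partial>regenerative_space W)"
    by (rule nn_integral_stationary_law)
  also have "\<dots> = (\<integral>\<^sup>+u. \<integral>\<^sup>+X. k (stationary_process (u, X) 0) \<partial>copies_space W \<partial>?U)"
    using measurable_stationary_process_regenerative[of 0 W]
    unfolding regenerative_space_def
    by (subst copies.nn_integral_fst[symmetric]) auto
  also have "\<dots> = (\<integral>\<^sup>+u. \<integral>\<^sup>+X. ?path (X 0) u \<partial>copies_space W \<partial>?U)"
  proof (rule nn_integral_cong_AE)
    have "AE u in ?U. 0 \<le> u \<and> u < 1"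
      using AE_lborel_singleton[of "1::real"]
      by (subst AE_uniform_measure) (auto elim!: eventually_mono)
    then show "AE u in ?U. (\<integral>\<^sup>+X. k (stationary_process (u, X) 0) \<partial>copies_space W) =
        (\<integral>\<^sup>+X. ?path (X 0) u \<partial>copies_space W)"
    proof eventually_elim
      case (elim u)
      show ?case
      proof (rule nn_integral_cong_AE)
        show "AE X in copies_space W. k (stationary_process (u, X) 0) = ?path (X 0) u"
          using AE_copies by eventually_elim (use elim in \<open>simp add: stationary_process_0\<close>)
      qed
    qed
  qed
  also have "\<dots> = (\<integral>\<^sup>+u. \<integral>\<^sup>+\<omega>. ?path \<omega> u \<partial>?B \<partial>?U)"
    by (simp add: marginal[of "\<lambda>\<omega>. ?path \<omega> _"])
  also have "\<dots> = (\<integral>\<^sup>+\<omega>. \<integral>\<^sup>+u. ?path \<omega> u \<partial>?U \<partial>?B)"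
    by (rule UB.Fubini'[symmetric]) (simp add: case_prod_beta)
  also have "\<dots> = (\<integral>\<^sup>+\<omega>. explosion_time \<omega> * (\<integral>\<^sup>+u. ?path \<omega> u \<partial>?U) \<partial>C1_law W) / mean_lifetime W"
  proof (subst nn_integral_size_biased_law)
    show "(\<lambda>\<omega>. \<integral>\<^sup>+u. ?path \<omega> u \<partial>?U) \<in> borel_measurable trajectory_space"
      by (rule U.borel_measurable_nn_integral) (simp add: case_prod_beta)
  qed (simp add: divide_ennreal_def)
  also have "(\<integral>\<^sup>+\<omega>. explosion_time \<omega> * (\<integral>\<^sup>+u. ?path \<omega> u \<partial>?U) \<partial>C1_law W) =
      (\<integral>\<^sup>+\<omega>. (\<Sum>n. k (graph_after \<omega> n) * ennreal (fst (\<omega> n))) \<partial>C1_law W)"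
  proof (rule nn_integral_cong_AE)
    show "AE \<omega> in C1_law W. explosion_time \<omega> * (\<integral>\<^sup>+u. ?path \<omega> u \<partial>?U) =
        (\<Sum>n. k (graph_after \<omega> n) * ennreal (fst (\<omega> n)))"
      using AE_C
    proof eventually_elim
      case (elim \<omega>)
      then show ?case
        using uniform_time_average[of \<omega> k] pos[of \<omega>] occupation_time[of \<omega> k]
        by (simp add: less_imp_le)
    qed
  qed
  also have "\<dots> = (\<Sum>n. \<integral>\<^sup>+\<omega>. k (graph_after \<omega> n) * ennreal (fst (\<omega> n)) \<partial>C1_law W)"
    by (rule nn_integral_suminf) measurable
  also have "\<dots> = (\<integral>\<^sup>+G. green W G * (k G * ennreal (1 / num_vertices G)) \<partial>count_space UNIV)"
    by (rule expected_occupation)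
  finally show ?thesis .
qed

lemma emeasure_stationary_law:
  assumes "mean_lifetime W < \<infinity>"
  shows "emeasure (stationary_law W 0) {G} = green W G * ennreal (1 / num_vertices G) / mean_lifetime W"
proof -
  have "emeasure (stationary_law W 0) {G} = (\<integral>\<^sup>+H. indicator {G} H \<partial>stationary_law W 0)"
    by (rule nn_integral_indicator[symmetric]) (simp add: stationary_law_def)
  also have "\<dots> = (\<integral>\<^sup>+H. green W H * (indicator {G} H * ennreal (1 / num_vertices H)) \<partial>count_space UNIV) /
      mean_lifetime W"
    by (rule stationary_law_formula[OF assms])
  also have "(\<lambda>H. green W H * (indicator {G} H * ennreal (1 / num_vertices H))) =
      (\<lambda>H. (green W G * ennreal (1 / num_vertices G)) * indicator {G} H)"
    by (auto simp: indicator_def)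
  also have "(\<integral>\<^sup>+H. (green W G * ennreal (1 / num_vertices G)) * indicator {G} H \<partial>count_space UNIV) =
      green W G * ennreal (1 / num_vertices G)"
    by (subst nn_integral_cmult_indicator) simp_all
  finally show ?thesis .
qed

section \<open>Stationarity as a fixed point equation\<close>

text \<open>Stationarity says that the Green function is \<open>c \<bar>G\<bar> W(G)\<close> with a finite \<open>c\<close>.\<close>

lemma stationary_imp_merge_law_fixpoint:
  assumes stat: "stationary_law W 0 = measure_pmf W"
  shows "merge_law W = W"
proof -
  have fin: "mean_lifetime W < \<infinity>"
  proof (rule ccontr)
    assume "\<not> mean_lifetime W < \<infinity>"
    then have "mean_lifetime W = \<infinity>" by (metis infinity_ennreal_def less_top)
    from stationary_law_null[OF this] show False unfolding stat by simp
  qed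
  have "green W G = mean_lifetime W * ennreal (num_vertices G) * ennreal (pmf W G)" for G
  proof -
    obtain c where c: "mean_lifetime W = ennreal c" "c > 0"
      using fin mean_lifetime_ge_1[of W] by (cases "mean_lifetime W") (auto simp: ennreal_ge_1)
    have n: "real (num_vertices G) > 0" using num_vertices_pos by simp
    have "ennreal (pmf W G) = green W G * ennreal (1 / num_vertices G) / mean_lifetime W"
      using emeasure_stationary_law[OF fin, of G] unfolding stat by (simp add: emeasure_pmf_single)
    also have "\<dots> = green W G * ennreal (1 / num_vertices G) * ennreal (1 / c)"
      using c by (simp add: divide_ennreal_def inverse_ennreal inverse_eq_divide)
    finally have "mean_lifetime W * ennreal (num_vertices G) * ennreal (pmf W G) =
        green W G * (ennreal c * ennreal (num_vertices G) * (ennreal (1 / num_vertices G) * ennreal (1 / c)))"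
      by (simp add: c mult_ac)
    also have "ennreal c * ennreal (num_vertices G) * (ennreal (1 / num_vertices G) * ennreal (1 / c)) = 1"
      using c n by (simp add: ennreal_mult'[symmetric])
    finally show ?thesis by simp
  qed
  then have "green W = (\<lambda>G. mean_lifetime W * ennreal (num_vertices G) * ennreal (pmf W G))" by blast
  with green_satisfies_renewal[of W] show ?thesis
    by (intro renewal_imp_merge_law_fixpoint[OF fin]) simp
qed

text \<open>By uniqueness of the renewal solution the Green function is \<open>2 \<bar>G\<bar> W(G)\<close>.  Summing the expected
  occupation times \<open>2 W(G)\<close> gives mean lifetime 2, so the process explodes.\<close>

lemma merge_law_fixpoint_imp_stationary:
  assumes "merge_law W = W"
  shows "explosive W \<and> stationary_law W 0 = measure_pmf W"
proof
  have green: "green W G = 2 * ennreal (num_vertices G) * ennreal (pmf W G)" for G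
    using satisfies_renewal_unique[OF green_satisfies_renewal merge_law_fixpoint_imp_renewal[OF assms]]
    by metis
  have per_vertex: "green W G * ennreal (1 / num_vertices G) = 2 * ennreal (pmf W G)" for G
  proof -
    have "real (num_vertices G) > 0" using num_vertices_pos by simp
    then have "ennreal (num_vertices G) * ennreal (1 / num_vertices G) = 1"
      by (simp add: ennreal_mult'[symmetric])
    moreover have "green W G * ennreal (1 / num_vertices G) =
        2 * ennreal (pmf W G) * (ennreal (num_vertices G) * ennreal (1 / num_vertices G))"
      by (simp add: green mult_ac)
    ultimately show ?thesis by simp
  qed
  have mean: "mean_lifetime W = 2"
    unfolding expected_explosion_time per_vertex by (simp add: nn_integral_cmult nn_integral_pmf)
  then have fin: "mean_lifetime W < \<infinity>" by simp
  then show "explosive W"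
    unfolding explosive_def using nn_integral_PInf_AE[of explosion_time "C1_law W"]
    by (simp add: less_top)
  show "stationary_law W 0 = measure_pmf W"
  proof (rule measure_eqI_countable[of _ UNIV])
    show "emeasure (stationary_law W 0) {G} = emeasure (measure_pmf W) {G}" for G
      unfolding emeasure_stationary_law[OF fin] per_vertex mean
      by (simp add: emeasure_pmf_single mult.commute[of 2] ennreal_mult_divide_eq)
  qed (auto simp: stationary_law_def)
qed

theorem lemma2:
  shows "(\<exists>!W0 :: graph_class pmf. explosive W0 \<and> stationary_law W0 0 = measure_pmf W0) \<and>
    (\<forall>W0 :: graph_class pmf. explosive W0 \<and> stationary_law W0 0 = measure_pmf W0 \<longrightarrow>
       (\<forall>k\<ge>1. measure_pmf.prob W0 {G. num_vertices G = k} =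
          2 / real k * real ((2 * k - 2) choose (k - 1)) / 4 ^ k) \<and>
       set_pmf W0 \<subseteq> rooted_trees)"
proof -
  have "explosive W \<and> stationary_law W 0 = measure_pmf W \<longleftrightarrow> merge_law W = W" for W
    using stationary_imp_merge_law_fixpoint merge_law_fixpoint_imp_stationary by blast
  then show ?thesis
    using merge_law_fixpoint_exists merge_law_fixpoint_unique merge_law_fixpoint_sizes
      merge_law_fixpoint_trees by (simp only:) blast
qed

end
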